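(* Let $G$ be a bipartite graph on the vertex set $[n]=\{1,\dots,n\}$. Then the following are equivalent: (i) $L_G$ is a complete intersection; (ii) $\mathcal{I}_G$ is a complete intersection; (iii) $G$ is a disjoint union of paths.
   Context: All graphs are finite and simple. Let $\mathbb{K}$ be any field and $S=\mathbb{K}[x_1,\dots,x_n,y_1,\dots,y_n]$. For a graph $G$ on $[n]$, the Lovász-Saks-Schrijver (LSS) ideal is $L_G=(x_ix_j+y_iy_j : \{i,j\}\in E(G))\subset S$ and the parity binomial edge ideal is $\mathcal{I}_G=(x_ix_j-y_iy_j : \{i,j\}\in E(G))\subset S$. A homogeneous ideal $I$ of $S$ is a complete intersection if $\mu(I)=\operatorname{ht}(I)$, where $\mu(I)$ is the cardinality of a minimal homogeneous generating set of $I$ and $\operatorname{ht}(I)$ its height. A single vertex counts as a path. *)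

theory Defs
  imports
    "HOL-Algebra.Ideal"
    "HOL-Library.Poly_Mapping"
    "HOL-Library.Extended_Nat"
begin

section \<open>Polynomial rings\<close>

text \<open>
  Monomials are finitely supported exponent functions, polynomials are finitely supported
  coefficient functions on monomials; the multiplication of \<^type>\<open>poly_mapping\<close> is convolution.
\<close>

type_synonym ('v, 'k) mpoly = "('v \<Rightarrow>\<^sub>0 nat) \<Rightarrow>\<^sub>0 'k"

definition poly_ring :: "'v set \<Rightarrow> ('v, 'k::field) mpoly ring" where
  "poly_ring V =
    \<lparr>carrier = {p :: ('v, 'k) mpoly. \<forall>m \<in> Poly_Mapping.keys p. Poly_Mapping.keys m \<subseteq> V},
     mult = (*), one = 1, zero = 0, add = (+)\<rparr>"

definition indet :: "'v \<Rightarrow> ('v, 'k::field) mpoly" where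
  "indet v = Poly_Mapping.single (Poly_Mapping.single v 1) 1"

definition mon_degree :: "('v \<Rightarrow>\<^sub>0 nat) \<Rightarrow> nat" where
  "mon_degree m = (\<Sum>v \<in> Poly_Mapping.keys m. Poly_Mapping.lookup m v)"

definition homogeneous :: "('v, 'k::field) mpoly \<Rightarrow> bool" where
  "homogeneous p \<longleftrightarrow> (\<exists>d. \<forall>m \<in> Poly_Mapping.keys p. mon_degree m = d)"

lemma poly_ring_cring: "cring (poly_ring V :: ('v, 'k::field) mpoly ring)"
proof -
  let ?C = "{p :: ('v, 'k) mpoly. \<forall>m \<in> Poly_Mapping.keys p. Poly_Mapping.keys m \<subseteq> V}"
  have add: "p + q \<in> ?C" if "p \<in> ?C" "q \<in> ?C" for p q
    using that Poly_Mapping.keys_add[of p q] by blast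
  have mult: "p * q \<in> ?C" if pq: "p \<in> ?C" "q \<in> ?C" for p q
  proof -
    have "Poly_Mapping.keys m \<subseteq> V" if m: "m \<in> Poly_Mapping.keys (p * q)" for m
    proof -
      obtain a b where "m = a + b" "a \<in> Poly_Mapping.keys p" "b \<in> Poly_Mapping.keys q"
        using m keys_mult[of p q] by blast
      then show ?thesis using pq Poly_Mapping.keys_add[of a b] by blast
    qed
    then show ?thesis by blast
  qed
  have neg: "\<exists>q \<in> ?C. q + p = 0" if "p \<in> ?C" for p
  proof
    show "- p + p = 0" by simp
    show "- p \<in> ?C" using that by (simp add: in_keys_iff)
  qed
  have one: "(1 :: ('v, 'k) mpoly) \<in> ?C" and zero: "(0 :: ('v, 'k) mpoly) \<in> ?C"
    by auto
  show ?thesis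
  proof (rule cringI)
    show "abelian_group (poly_ring V :: ('v, 'k) mpoly ring)"
      unfolding poly_ring_def
      by (rule abelian_groupI; simp only: ring.simps partial_object.simps monoid.simps)
        (rule add zero neg add.assoc add.commute add_0_left; assumption)+
    show "Group.comm_monoid (poly_ring V :: ('v, 'k) mpoly ring)"
      unfolding poly_ring_def
      by (rule Group.comm_monoidI; simp only: ring.simps partial_object.simps monoid.simps)
        (rule mult one mult.assoc mult.commute mult_1_left; assumption)+
    show "(x \<oplus>\<^bsub>poly_ring V\<^esub> y) \<otimes>\<^bsub>poly_ring V\<^esub> z =
        x \<otimes>\<^bsub>poly_ring V\<^esub> z \<oplus>\<^bsub>poly_ring V\<^esub> y \<otimes>\<^bsub>poly_ring V\<^esub> z"
      for x y z :: "('v, 'k) mpoly"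
      unfolding poly_ring_def by (simp add: distrib_right)
  qed
qed

section \<open>Height and complete intersections\<close>

definition prime_height :: "('a, 'b) ring_scheme \<Rightarrow> 'a set \<Rightarrow> enat" where
  "prime_height R P =
    Sup {enat k | k. \<exists>Q :: nat \<Rightarrow> 'a set.
      (\<forall>i \<le> k. primeideal (Q i) R) \<and> (\<forall>i < k. Q i \<subset> Q (Suc i)) \<and> Q k = P}"

definition height :: "('a, 'b) ring_scheme \<Rightarrow> 'a set \<Rightarrow> enat" where
  "height R I = Inf {prime_height R P | P. primeideal P R \<and> I \<subseteq> P}"

definition homogeneous_generating_set ::
    "'v set \<Rightarrow> ('v, 'k::field) mpoly set \<Rightarrow> ('v, 'k) mpoly set \<Rightarrow> bool" where
  "homogeneous_generating_set V I B \<longleftrightarrow>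
    B \<subseteq> carrier (poly_ring V) \<and> (\<forall>p \<in> B. homogeneous p) \<and> Idl\<^bsub>poly_ring V\<^esub> B = I"

definition homogeneous_ideal :: "'v set \<Rightarrow> ('v, 'k::field) mpoly set \<Rightarrow> bool" where
  "homogeneous_ideal V I \<longleftrightarrow> (\<exists>B. homogeneous_generating_set V I B)"

definition minimal_homogeneous_generating_set ::
    "'v set \<Rightarrow> ('v, 'k::field) mpoly set \<Rightarrow> ('v, 'k) mpoly set \<Rightarrow> bool" where
  "minimal_homogeneous_generating_set V I B \<longleftrightarrow>
    homogeneous_generating_set V I B \<and> (\<forall>B'. B' \<subset> B \<longrightarrow> \<not> homogeneous_generating_set V I B')"

text \<open>
  For a homogeneous ideal and a finite set of variables, all inclusion-minimal homogeneous
  generating sets are finite and, by the graded Nakayama lemma, of the same cardinality; hence the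
  definite description.
\<close>

definition min_num_generators :: "'v set \<Rightarrow> ('v, 'k::field) mpoly set \<Rightarrow> nat" where
  "min_num_generators V I =
    (THE k. \<exists>B. minimal_homogeneous_generating_set V I B \<and> finite B \<and> card B = k)"

definition complete_intersection :: "'v set \<Rightarrow> ('v, 'k::field) mpoly set \<Rightarrow> bool" where
  "complete_intersection V I \<longleftrightarrow>
    homogeneous_ideal V I \<and> enat (min_num_generators V I) = height (poly_ring V) I"

section \<open>Graphs on the vertex set \<open>{1..n}\<close>\<close>

definition simple_graph :: "nat \<Rightarrow> nat set set \<Rightarrow> bool" where
  "simple_graph n E \<longleftrightarrow> (\<forall>e \<in> E. e \<subseteq> {1..n} \<and> card e = 2)"

definition bipartite :: "nat \<Rightarrow> nat set set \<Rightarrow> bool" where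
  "bipartite n E \<longleftrightarrow>
    (\<exists>A B. A \<union> B = {1..n} \<and> A \<inter> B = {} \<and> (\<forall>e \<in> E. \<exists>a \<in> A. \<exists>b \<in> B. e = {a, b}))"

text \<open>A path is given by the list of its vertices in order; singleton lists have no edges.\<close>

definition path_edges :: "nat list \<Rightarrow> nat set set" where
  "path_edges vs = {{vs ! i, vs ! Suc i} | i. Suc i < length vs}"

definition disjoint_union_of_paths :: "nat \<Rightarrow> nat set set \<Rightarrow> bool" where
  "disjoint_union_of_paths n E \<longleftrightarrow>
    (\<exists>Ps :: nat list set.
      (\<forall>vs \<in> Ps. vs \<noteq> [] \<and> distinct vs) \<and>
      pairwise (\<lambda>vs ws. disjnt (set vs) (set ws)) Ps \<and>
      (\<Union>vs \<in> Ps. set vs) = {1..n} \<and>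
      (\<Union>vs \<in> Ps. path_edges vs) = E)"

section \<open>The two ideals of a graph\<close>

datatype var = X nat | Y nat

definition graph_vars :: "nat \<Rightarrow> var set" where
  "graph_vars n = X ` {1..n} \<union> Y ` {1..n}"

definition lss_ideal :: "nat \<Rightarrow> nat set set \<Rightarrow> (var, 'k::field) mpoly set" where
  "lss_ideal n E = Idl\<^bsub>poly_ring (graph_vars n)\<^esub>
    {indet (X i) * indet (X j) + indet (Y i) * indet (Y j) | i j. {i, j} \<in> E}"

definition parity_binomial_edge_ideal :: "nat \<Rightarrow> nat set set \<Rightarrow> (var, 'k::field) mpoly set" where
  "parity_binomial_edge_ideal n E = Idl\<^bsub>poly_ring (graph_vars n)\<^esub>
    {indet (X i) * indet (X j) - indet (Y i) * indet (Y j) | i j. {i, j} \<in> E}"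

end

theory Submission
  imports Defs "HOL-Computational_Algebra.Polynomial"
begin

text \<open>
  Both ideals are generated by the quadrics \<open>x\<^sub>i x\<^sub>j + c y\<^sub>i y\<^sub>j\<close> with \<open>c = \<plusminus>1\<close>. They are linearly
  independent, so that \<open>\<mu> = |E|\<close>, and it remains to compare the height with \<open>|E|\<close>.

  Lower bound for unions of paths: let \<open>j\<close> be a leaf with neighbour \<open>i\<close>, and \<open>P\<close> a prime containing
  the ideal. A deformation of the polynomial ring over a new variable \<open>T\<close>, moving only the variables
  of \<open>j\<close> or only those of \<open>i\<close>, preserves the other generators modulo \<open>P\<close>, but moves some element of
  \<open>P\<close> out of \<open>P[T]\<close>. Pulling back \<open>P[T]\<close> gives a strictly smaller prime containing the ideal of the
  graph without the edge \<open>{i, j}\<close>; iterating, \<open>P\<close> has height at least \<open>|E|\<close>.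

  Upper bound: given a set \<open>S\<close> of vertices and a map \<open>r\<close> that is constant on the edges avoiding \<open>S\<close>,
  the ideal lies in the kernel of a monomial parametrization (up to signs) whose image has
  transcendence degree \<open>n - |S| + |r([n] - S)|\<close>. Elements that are algebraically independent modulo a
  prime can be enlarged along a descending chain of primes, so this kernel has height at most
  \<open>n + |S| - |r([n] - S)|\<close>. With \<open>S\<close> empty and \<open>r\<close> the component map this is at most \<open>|E|\<close>, and less if
  there is a cycle; if a vertex \<open>v\<close> has degree at least three, then \<open>S = {v}\<close> gives less than \<open>|E|\<close>.
\<close>

section \<open>Polynomial rings and substitutions\<close>

abbreviation polys :: "'v set \<Rightarrow> ('v, 'k::field) mpoly set" where
  "polys V \<equiv> carrier (poly_ring V)"

lemma poly_ring_simps [simp]: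
  "monoid.mult (poly_ring V) = (*)" "monoid.one (poly_ring V) = 1"
  "ring.zero (poly_ring V) = 0" "ring.add (poly_ring V) = (+)"
  by (simp_all add: poly_ring_def)

lemma mem_polys_iff: "p \<in> polys V \<longleftrightarrow> (\<forall>m \<in> Poly_Mapping.keys p. Poly_Mapping.keys m \<subseteq> V)"
  by (simp add: poly_ring_def)

lemma polys_closed [simp]:
  "(0 :: ('v, 'k::field) mpoly) \<in> polys V" "(1 :: ('v, 'k::field) mpoly) \<in> polys V"
  "p \<in> polys V \<Longrightarrow> q \<in> polys V \<Longrightarrow> p + q \<in> (polys V :: ('v, 'k::field) mpoly set)"
  "p \<in> polys V \<Longrightarrow> q \<in> polys V \<Longrightarrow> p * q \<in> (polys V :: ('v, 'k::field) mpoly set)"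
  using cring.cring_simprules(2,6,1,5)[OF poly_ring_cring[of V]] by simp_all

lemma polys_minus [simp]:
  "p \<in> polys V \<Longrightarrow> - p \<in> (polys V :: ('v, 'k::field) mpoly set)"
  "p \<in> polys V \<Longrightarrow> q \<in> polys V \<Longrightarrow> p - q \<in> (polys V :: ('v, 'k::field) mpoly set)"
  using polys_closed(3)[of p V "- q"] by (auto simp: mem_polys_iff in_keys_iff)

lemma polys_single: "Poly_Mapping.keys m \<subseteq> V \<Longrightarrow> Poly_Mapping.single m a \<in> polys V"
  by (simp add: mem_polys_iff)

lemma polys_const [simp]: "Poly_Mapping.single 0 a \<in> polys V"
  by (simp add: polys_single)

lemma polys_indet [simp]: "v \<in> V \<Longrightarrow> indet v \<in> polys V"
  by (simp add: polys_single indet_def)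

lemma polys_sum: "(\<And>i. i \<in> I \<Longrightarrow> f i \<in> polys V) \<Longrightarrow> sum f I \<in> polys V"
  by (induction I rule: infinite_finite_induct) auto

lemma polys_power [simp]: "p \<in> polys V \<Longrightarrow> p ^ n \<in> polys V"
  by (induction n) auto

section \<open>Ideals and prime ideals of the polynomial ring in elementary terms\<close>

lemma ideal_poly_ring_iff:
  fixes I :: "('v, 'k::field) mpoly set"
  shows "ideal I (poly_ring V) \<longleftrightarrow>
    I \<subseteq> polys V \<and> 0 \<in> I \<and> (\<forall>a \<in> I. \<forall>b \<in> I. a + b \<in> I) \<and> (\<forall>r \<in> polys V. \<forall>a \<in> I. r * a \<in> I)"
  (is "_ \<longleftrightarrow> ?r")
proof
  assume i: "ideal I (poly_ring V)"
  then have s: "additive_subgroup I (poly_ring V)"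
    by (rule ideal.axioms)
  have "I \<subseteq> polys V"
    using additive_subgroup.a_subset[OF s] .
  moreover have "0 \<in> I"
    using additive_subgroup.zero_closed[OF s] unfolding poly_ring_simps .
  moreover have "a + b \<in> I" if "a \<in> I" "b \<in> I" for a b
    using additive_subgroup.a_closed[OF s that] unfolding poly_ring_simps .
  moreover have "r * a \<in> I" if "r \<in> polys V" "a \<in> I" for r a
    using ideal.I_l_closed[OF i that(2,1)] unfolding poly_ring_simps .
  ultimately show ?r
    by blast
next
  assume r: ?r
  have R: "cring (poly_ring V :: ('v, 'k) mpoly ring)"
    by (rule poly_ring_cring)
  show "ideal I (poly_ring V)"
  proof (rule idealI)
    show "ring (poly_ring V :: ('v, 'k) mpoly ring)"
      using R by (rule cring.axioms)
    then have G: "group (add_monoid (poly_ring V :: ('v, 'k) mpoly ring))"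
      by (intro abelian_group.a_group ring.is_abelian_group)
    show "subgroup I (add_monoid (poly_ring V))"
    proof (rule group.subgroupI[OF G])
      show "I \<subseteq> carrier (add_monoid (poly_ring V))" "I \<noteq> {}"
        using r by auto
      show "a \<otimes>\<^bsub>add_monoid (poly_ring V)\<^esub> b \<in> I" if "a \<in> I" "b \<in> I" for a b
        using r that by simp
      fix a assume a: "a \<in> I"
      then have "a \<in> polys V" using r by auto
      then have "inv\<^bsub>add_monoid (poly_ring V)\<^esub> a = (-1) * a"
        by (intro group.inv_equality[OF G]) simp_all
      moreover have "(-1) * a \<in> I"
        using r a polys_minus(1)[OF polys_closed(2)] by blast
      ultimately show "inv\<^bsub>add_monoid (poly_ring V)\<^esub> a \<in> I" by simp
    qed
    show "x \<otimes>\<^bsub>poly_ring V\<^esub> a \<in> I" if "a \<in> I" "x \<in> polys V" for a x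
      using that r by simp
    show "a \<otimes>\<^bsub>poly_ring V\<^esub> x \<in> I" if "a \<in> I" "x \<in> polys V" for a x
      using that r by (simp add: mult.commute[of a x])
  qed
qed

lemma primeideal_poly_ring_iff:
  fixes P :: "('v, 'k::field) mpoly set"
  shows "primeideal P (poly_ring V) \<longleftrightarrow>
    ideal P (poly_ring V) \<and> 1 \<notin> P \<and>
    (\<forall>a \<in> polys V. \<forall>b \<in> polys V. a * b \<in> P \<longrightarrow> a \<in> P \<or> b \<in> P)"
proof -
  have "1 \<in> P \<longleftrightarrow> polys V = P" if "ideal P (poly_ring V)"
    using that unfolding ideal_poly_ring_iff by (metis mult.right_neutral polys_closed(2) subsetI subset_antisym)
  then show ?thesis
    using poly_ring_cring[of V]
    by (auto simp: primeideal_def primeideal_axioms_def)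
qed

lemma primeideal_imp_ideal: "primeideal P R \<Longrightarrow> ideal P R"
  by (simp add: primeideal_def)

lemma ideal_poly_ringD:
  assumes "ideal I (poly_ring V)"
  shows "I \<subseteq> polys V" "0 \<in> I" "a \<in> I \<Longrightarrow> b \<in> I \<Longrightarrow> a + b \<in> I" "r \<in> polys V \<Longrightarrow> a \<in> I \<Longrightarrow> r * a \<in> I"
    "a \<in> I \<Longrightarrow> b \<in> I \<Longrightarrow> a - b \<in> I"
proof -
  note i = assms[unfolded ideal_poly_ring_iff]
  show "I \<subseteq> polys V" "0 \<in> I" "a \<in> I \<Longrightarrow> b \<in> I \<Longrightarrow> a + b \<in> I" "r \<in> polys V \<Longrightarrow> a \<in> I \<Longrightarrow> r * a \<in> I"
    using i by auto
  assume ab: "a \<in> I" "b \<in> I"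
  have "(-1) * b \<in> I" using i ab polys_minus(1)[OF polys_closed(2)] by blast
  then have "a + (-1) * b \<in> I" using i ab by blast
  then show "a - b \<in> I" by simp
qed

lemma ideal_sum: "ideal I (poly_ring V) \<Longrightarrow> (\<And>i. i \<in> A \<Longrightarrow> f i \<in> I) \<Longrightarrow> sum f A \<in> I"
  by (induction A rule: infinite_finite_induct) (auto intro: ideal_poly_ringD)

lemma prime_power_mem:
  assumes "primeideal P (poly_ring V)" "f \<in> polys V" "g \<in> polys V" "f ^ n * g \<in> P" "f \<notin> P"
  shows "g \<in> P"
  using assms(4)
proof (induction n)
  case (Suc n)
  then have "f * (f ^ n * g) \<in> P" by (simp add: mult.assoc)
  then show ?case
    using assms Suc.IH unfolding primeideal_poly_ring_iff by (meson polys_closed(4) polys_power)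
qed simp

section \<open>Evaluation of polynomials along a map of coefficients\<close>

lemma poly_mapping_decompose:
  "p = (\<Sum>m\<in>Poly_Mapping.keys p. Poly_Mapping.single m (Poly_Mapping.lookup p m))"
  by (rule poly_mapping_eqI) (simp add: lookup_sum lookup_single when_def in_keys_iff)

text \<open>Evaluation with \<open>h\<close> on coefficients and \<open>s\<close> on variables; it
  is a ring homomorphism once \<open>h\<close> is one (\<open>coeff_hom\<close>). The target is left
  general because it is used twice: with polynomials in \<open>T\<close> over the polynomial ring
  for deformations, and with a second polynomial ring for parametrizations.\<close>

definition insertion ::
    "('k \<Rightarrow> 'b) \<Rightarrow> ('v \<Rightarrow> 'b) \<Rightarrow> ('v, 'k::field) mpoly \<Rightarrow> 'b::comm_ring_1" where
  "insertion h s p = (\<Sum>m\<in>Poly_Mapping.keys p.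
     h (Poly_Mapping.lookup p m) * (\<Prod>v\<in>Poly_Mapping.keys m. s v ^ Poly_Mapping.lookup m v))"

locale coeff_hom =
  fixes h :: "'k::field \<Rightarrow> 'b::comm_ring_1"
  assumes h_add: "h (a + b) = h a + h b" and h_mult: "h (a * b) = h a * h b" and h_one: "h 1 = 1"
begin

lemma h_zero: "h 0 = 0"
  using h_add[of 0 0] by simp

lemma insertion_single:
  "insertion h s (Poly_Mapping.single m a) =
    h a * (\<Prod>v\<in>Poly_Mapping.keys m. s v ^ Poly_Mapping.lookup m v)"
  by (simp add: insertion_def h_zero)

lemma insertion_add: "insertion h s (p + q) = insertion h s p + insertion h s q"
  unfolding insertion_def
  by (rule setsum_keys_plus_distrib) (simp_all add: h_zero h_add distrib_right)

lemma insertion_zero: "insertion h s 0 = 0"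
  by (simp add: insertion_def)

lemma insertion_sum: "insertion h s (sum f A) = (\<Sum>i\<in>A. insertion h s (f i))"
  by (induction A rule: infinite_finite_induct) (auto simp: insertion_add insertion_zero)

lemma eval_monomial_add:
  fixes s :: "'v \<Rightarrow> 'b"
  shows "(\<Prod>v\<in>Poly_Mapping.keys (m + n). s v ^ Poly_Mapping.lookup (m + n) v) =
   (\<Prod>v\<in>Poly_Mapping.keys m. s v ^ Poly_Mapping.lookup m v) *
   (\<Prod>v\<in>Poly_Mapping.keys n. s v ^ Poly_Mapping.lookup n v)"
proof -
  let ?K = "Poly_Mapping.keys m \<union> Poly_Mapping.keys n"
  have ext: "(\<Prod>v\<in>Poly_Mapping.keys k. s v ^ Poly_Mapping.lookup k v) =
      (\<Prod>v\<in>?K. s v ^ Poly_Mapping.lookup k v)" if "Poly_Mapping.keys k \<subseteq> ?K" for k :: "'v \<Rightarrow>\<^sub>0 nat"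
    using that by (intro prod.mono_neutral_left) (auto simp: in_keys_iff)
  show ?thesis
    unfolding ext[OF Poly_Mapping.keys_add] ext[OF Un_upper1] ext[OF Un_upper2]
    by (simp add: lookup_add power_add prod.distrib)
qed

lemma insertion_mult: "insertion h s (p * q) = insertion h s p * insertion h s q"
proof -
  define A where "A = Poly_Mapping.keys p"
  define B where "B = Poly_Mapping.keys q"
  define f where "f = (\<lambda>m. Poly_Mapping.single m (Poly_Mapping.lookup p m))"
  define g where "g = (\<lambda>m. Poly_Mapping.single m (Poly_Mapping.lookup q m))"
  have pq: "p = sum f A" "q = sum g B"
    unfolding f_def g_def A_def B_def by (rule poly_mapping_decompose)+
  have fg: "insertion h s (f m * g n) = insertion h s (f m) * insertion h s (g n)" for m n
    by (simp add: f_def g_def mult_single insertion_single eval_monomial_add h_mult)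
  show ?thesis
    unfolding pq by (simp add: sum_product insertion_sum fg)
qed

lemma insertion_const: "insertion h s (Poly_Mapping.single 0 a) = h a"
  by (simp add: insertion_single)

lemma insertion_one: "insertion h s 1 = 1"
  using insertion_const[of s 1] by (simp add: h_one)

lemma insertion_indet: "insertion h s (indet v) = s v"
  by (simp add: indet_def insertion_single h_one)

lemma insertion_power: "insertion h s (p ^ n) = insertion h s p ^ n"
  by (induction n) (auto simp: insertion_one insertion_mult)

end

section \<open>Deforming a prime ideal\<close>

lemma indet_power: "indet v ^ n = Poly_Mapping.single (Poly_Mapping.single v n) 1"
  by (induction n) (simp_all add: indet_def mult_single single_add[symmetric])

lemma prod_single_one:
  "(\<Prod>i\<in>I. Poly_Mapping.single (f i) (1::'b::comm_ring_1)) = Poly_Mapping.single (\<Sum>i\<in>I. f i) 1"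
  by (induction I rule: infinite_finite_induct) (simp_all add: mult_single)

lemma monomial_prod_indet:
  "Poly_Mapping.single m a =
    Poly_Mapping.single 0 a * (\<Prod>v\<in>Poly_Mapping.keys m. indet v ^ Poly_Mapping.lookup m v)"
  unfolding indet_power prod_single_one poly_mapping_decompose[of m, symmetric]
  by (simp add: mult_single)

text \<open>The deformation sending each variable \<open>v\<close> to
  \<open>indet v + T * t v\<close>, with \<open>T\<close> the variable of the univariate polynomial
  type.\<close>

definition shift :: "('v \<Rightarrow> ('v, 'k::field) mpoly) \<Rightarrow> ('v, 'k) mpoly \<Rightarrow> ('v, 'k) mpoly poly" where
  "shift t = insertion (\<lambda>a. [:Poly_Mapping.single 0 a:]) (\<lambda>v. [:indet v, t v:])"

interpretation const_poly: coeff_hom "\<lambda>a::'k::field. [:Poly_Mapping.single (0::'v \<Rightarrow>\<^sub>0 nat) a:]"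
  by standard (simp_all add: single_add mult_single mult.commute)

lemma shift_simps:
  "shift t (p + q) = shift t p + shift t q" "shift t (p * q) = shift t p * shift t q"
  "shift t 0 = 0" "shift t 1 = 1" "shift t (indet v) = [:indet v, t v:]"
  "shift t (Poly_Mapping.single 0 a) = [:Poly_Mapping.single 0 a:]"
  unfolding shift_def
  by (fact const_poly.insertion_add const_poly.insertion_mult const_poly.insertion_zero
    const_poly.insertion_one const_poly.insertion_indet const_poly.insertion_const)+

text \<open>The constant coefficient is the value at \<open>T = 0\<close>, where every variable is
  sent to itself.\<close>

lemma coeff_shift_0: "coeff (shift t f) 0 = f"
proof -
  have "poly (shift t f) 0 = (\<Sum>m\<in>Poly_Mapping.keys f. Poly_Mapping.single 0 (Poly_Mapping.lookup f m) *
      (\<Prod>v\<in>Poly_Mapping.keys m. indet v ^ Poly_Mapping.lookup m v))"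
    by (simp add: shift_def insertion_def poly_sum poly_prod)
  also have "\<dots> = f"
    unfolding monomial_prod_indet[symmetric] by (rule poly_mapping_decompose[symmetric])
  finally show ?thesis by (simp add: poly_0_coeff_0)
qed

lemma coeff_mult_polys:
  assumes "\<And>n. coeff p n \<in> polys V" "\<And>n. coeff q n \<in> polys V"
  shows "coeff (p * q) n \<in> polys V"
  unfolding coeff_mult by (intro polys_sum polys_closed assms)

lemma coeff_pCons_polys:
  "a \<in> polys V \<Longrightarrow> (\<And>n. coeff p n \<in> polys V) \<Longrightarrow> coeff (pCons a p) n \<in> polys V"
  by (cases n) auto

lemma coeff_shift_polys:
  assumes t: "\<And>v. v \<in> V \<Longrightarrow> t v \<in> polys V" and f: "f \<in> polys V"
  shows "coeff (shift t f) n \<in> polys V"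
proof -
  have pow: "coeff (p ^ k) n \<in> polys V" if "\<And>n. coeff p n \<in> polys V" for p :: "('a, 'b) mpoly poly" and k n
    by (induction k arbitrary: n) (auto intro: coeff_mult_polys that simp: coeff_1)
  have prd: "coeff (prod F A) n \<in> polys V" if "\<And>v n. v \<in> A \<Longrightarrow> coeff (F v) n \<in> polys V"
    for F :: "'a \<Rightarrow> ('a, 'b) mpoly poly" and A n
    using that by (induction A arbitrary: n rule: infinite_finite_induct) (auto intro: coeff_mult_polys simp: coeff_1)
  show ?thesis
    unfolding shift_def insertion_def coeff_sum
  proof (rule polys_sum, rule coeff_mult_polys)
    fix m n assume m: "m \<in> Poly_Mapping.keys f"
    show "coeff [:Poly_Mapping.single 0 (Poly_Mapping.lookup f m):] n \<in> polys V"
      by (rule coeff_pCons_polys) auto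
    have "v \<in> V" if "v \<in> Poly_Mapping.keys m" for v
      using f m that unfolding mem_polys_iff by auto
    then show "coeff (\<Prod>v\<in>Poly_Mapping.keys m. [:indet v, t v:] ^ Poly_Mapping.lookup m v) n \<in> polys V"
      using t by (intro prd pow coeff_pCons_polys) auto
  qed
qed

text \<open>Pulling the prime ideal \<open>P[T]\<close> back along a deformation gives a smaller prime ideal,
  since the deformation is the identity at \<open>T = 0\<close>.\<close>

lemma prime_deformation:
  assumes P: "primeideal P (poly_ring V)" and t: "\<And>v. v \<in> V \<Longrightarrow> t v \<in> polys V"
  defines "Q \<equiv> {f \<in> polys V. \<forall>n. coeff (shift t f) n \<in> P}"
  shows "primeideal Q (poly_ring V)" "Q \<subseteq> P"
proof -
  note I = ideal_poly_ringD[OF primeideal_imp_ideal[OF P]]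
  note Pi = P[unfolded primeideal_poly_ring_iff]
  show sub: "Q \<subseteq> P"
    unfolding Q_def using coeff_shift_0 by (metis (mono_tags, lifting) mem_Collect_eq subsetI)
  show "primeideal Q (poly_ring V)"
    unfolding primeideal_poly_ring_iff
  proof (intro conjI ballI impI)
    show "ideal Q (poly_ring V)"
      unfolding ideal_poly_ring_iff
    proof (intro conjI ballI)
      show "Q \<subseteq> polys V" by (auto simp: Q_def)
      show "0 \<in> Q" using I by (simp add: Q_def shift_simps)
      show "a + b \<in> Q" if "a \<in> Q" "b \<in> Q" for a b
        using that I by (simp add: Q_def shift_simps)
      show "r * a \<in> Q" if "r \<in> polys V" "a \<in> Q" for r a
        using that I coeff_shift_polys[OF t]
        by (auto simp: Q_def shift_simps coeff_mult intro!: ideal_sum[OF primeideal_imp_ideal[OF P]])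
    qed
    show "1 \<notin> Q"
      using sub Pi by auto
    fix a b assume a: "a \<in> polys V" and b: "b \<in> polys V" and ab: "a * b \<in> Q"
    let ?A = "coeff (shift t a)" and ?B = "coeff (shift t b)"
    have cl: "?A n \<in> polys V" "?B n \<in> polys V" for n
      using a b coeff_shift_polys[OF t] by auto
    show "a \<in> Q \<or> b \<in> Q"
    proof (rule ccontr)
      assume "\<not> ?thesis"
      then have ex: "\<exists>i. ?A i \<notin> P" "\<exists>j. ?B j \<notin> P"
        using a b by (auto simp: Q_def)
      \<comment> \<open>This is the argument that \<open>P[T]\<close> is prime: take the lowest
        coefficients of both factors outside \<open>P\<close>. In the coefficient of index
        \<open>i + j\<close> of the product, every summand other than \<open>?A i * ?B j\<close> has
        a factor of smaller index and so lies in \<open>P\<close>.\<close>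
      define i where "i = (LEAST i. ?A i \<notin> P)"
      define j where "j = (LEAST j. ?B j \<notin> P)"
      have ij: "?A i \<notin> P" "?B j \<notin> P"
        unfolding i_def j_def using LeastI_ex[OF ex(1)] LeastI_ex[OF ex(2)] by blast+
      have less: "?A k \<in> P" if "k < i" for k
        using that not_less_Least unfolding i_def by blast
      have less': "?B k \<in> P" if "k < j" for k
        using that not_less_Least unfolding j_def by blast
      have rest: "(\<Sum>k\<in>{..i+j} - {i}. ?A k * ?B (i + j - k)) \<in> P"
      proof (rule ideal_sum[OF primeideal_imp_ideal[OF P]])
        fix k assume k: "k \<in> {..i+j} - {i}"
        show "?A k * ?B (i + j - k) \<in> P"
        proof (cases "k < i")
          case True
          then show ?thesis using I(4)[OF cl(2) less] by (simp add: mult.commute)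
        next
          case False
          then have "i + j - k < j" using k by auto
          then show ?thesis using I(4)[OF cl(1) less'] by blast
        qed
      qed
      have "(\<Sum>k\<le>i+j. ?A k * ?B (i + j - k)) \<in> P"
        using ab by (simp add: Q_def shift_simps coeff_mult)
      then have "?A i * ?B j + (\<Sum>k\<in>{..i+j} - {i}. ?A k * ?B (i + j - k)) \<in> P"
        by (subst (asm) sum.remove[of _ i]) auto
      from I(5)[OF this rest] have "?A i * ?B j \<in> P" by simp
      then show False using ij Pi cl by blast
    qed
  qed
qed

text \<open>\<open>A\<close> collects the generators to be kept, and \<open>g\<close> witnesses
  strictness: it lies in \<open>P\<close>, but a coefficient of its deformation escapes
  \<open>P\<close>, so \<open>g\<close> is not in the pullback of \<open>P[T]\<close>.\<close>

lemma smaller_prime_by_deformation: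
  assumes P: "primeideal P (poly_ring V)" and t: "\<And>v. v \<in> V \<Longrightarrow> t v \<in> polys V"
    and A: "\<And>f. f \<in> A \<Longrightarrow> f \<in> polys V" "\<And>f n. f \<in> A \<Longrightarrow> coeff (shift t f) n \<in> P"
    and g: "g \<in> P" "coeff (shift t g) n \<notin> P"
  shows "\<exists>Q. primeideal Q (poly_ring V) \<and> Q \<subset> P \<and> A \<subseteq> Q"
proof -
  let ?Q = "{f \<in> polys V. \<forall>n. coeff (shift t f) n \<in> P}"
  have "g \<notin> ?Q" using g by auto
  then have "?Q \<subset> P"
    using prime_deformation(2)[where t = t, OF P t] g by auto
  moreover have "A \<subseteq> ?Q" using A by auto
  ultimately show ?thesis
    using prime_deformation(1)[where t = t, OF P t] by blast
qed

text \<open>The generator attached to an edge; \<open>c = 1\<close> for the LSS ideal and \<open>c = -1\<close> for the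
  parity binomial edge ideal.\<close>

definition edge_gen :: "'k::field \<Rightarrow> nat \<Rightarrow> nat \<Rightarrow> (var, 'k) mpoly" where
  "edge_gen c i j =
    indet (X i) * indet (X j) + Poly_Mapping.single 0 c * (indet (Y i) * indet (Y j))"

definition edge_gens :: "'k::field \<Rightarrow> nat set set \<Rightarrow> (var, 'k) mpoly set" where
  "edge_gens c E = {edge_gen c i j | i j. {i, j} \<in> E}"

lemma edge_gen_commute: "edge_gen c i j = edge_gen c j i"
  by (simp add: edge_gen_def mult.commute)

lemma graph_vars_iff [simp]: "X i \<in> graph_vars n \<longleftrightarrow> i \<in> {1..n}" "Y i \<in> graph_vars n \<longleftrightarrow> i \<in> {1..n}"
  by (auto simp: graph_vars_def)

lemma edge_gen_polys: "i \<in> {1..n} \<Longrightarrow> j \<in> {1..n} \<Longrightarrow> edge_gen c i j \<in> polys (graph_vars n)"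
  by (simp add: edge_gen_def)

lemma edge_gens_polys:
  "(\<And>e. e \<in> E \<Longrightarrow> e \<subseteq> {1..n}) \<Longrightarrow> edge_gens c E \<subseteq> polys (graph_vars n)"
  unfolding edge_gens_def using edge_gen_polys by fastforce

lemma shift_edge_gen:
  "shift t (edge_gen c i j) =
    [:edge_gen c i j,
      indet (X i) * t (X j) + t (X i) * indet (X j) +
        Poly_Mapping.single 0 c * (indet (Y i) * t (Y j) + t (Y i) * indet (Y j)),
      t (X i) * t (X j) + Poly_Mapping.single 0 c * (t (Y i) * t (Y j)):]"
  by (simp add: edge_gen_def shift_simps algebra_simps)

text \<open>The vertex \<open>k\<close> stands for the only possible neighbour of \<open>i\<close>
  besides \<open>j\<close>; if there is none, any vertex will do. Which coordinates of
  \<open>i\<close> and \<open>k\<close> lie in \<open>P\<close> decides which variables are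
  moved.\<close>

lemma leaf_removal_step:
  fixes P :: "(var, 'k::field) mpoly set"
  assumes P: "primeideal P (poly_ring (graph_vars n))" and gens: "edge_gens c E \<subseteq> P"
    and c: "c \<noteq> 0" and E: "\<And>e. e \<in> E \<Longrightarrow> e \<subseteq> {1..n} \<and> card e = 2"
    and ij: "{i, j} \<in> E" and leaf: "\<And>e. e \<in> E \<Longrightarrow> j \<in> e \<Longrightarrow> e = {i, j}"
    and k: "k \<in> {1..n}" "\<And>e. e \<in> E \<Longrightarrow> i \<in> e \<Longrightarrow> e = {i, j} \<or> e = {i, k}"
  shows "\<exists>Q. primeideal Q (poly_ring (graph_vars n)) \<and> Q \<subset> P \<and> edge_gens c (E - {{i, j}}) \<subseteq> Q"
proof -
  let ?V = "graph_vars n" and ?E = "E - {{i, j}}"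
  note I = ideal_poly_ringD[OF primeideal_imp_ideal[OF P]]
  note Pi = P[unfolded primeideal_poly_ring_iff]
  have ne: "i \<noteq> j" and ijn: "i \<in> {1..n}" "j \<in> {1..n}"
    using E[OF ij] by auto
  have gP: "edge_gen c a b \<in> P" if "{a, b} \<in> E" for a b
    using that gens by (auto simp: edge_gens_def)
  have pcE: "f \<in> polys ?V" if "f \<in> edge_gens c ?E" for f
    using that edge_gens_polys[of ?E n c] E by auto
  \<comment> \<open>A remaining edge can be written as \<open>{a, b}\<close> with \<open>b\<close>
    different from \<open>i\<close>, so that a deformation moving the variables of \<open>i\<close>
    only needs the case \<open>a = i\<close>.\<close>
  have split: "f \<in> edge_gens c ?E \<Longrightarrow> (\<And>a b. {a, b} \<in> ?E \<Longrightarrow> a \<noteq> b \<Longrightarrow> b \<noteq> i \<Longrightarrow> Q (edge_gen c a b)) \<Longrightarrow> Q f"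
    for f and Q :: "(var, 'k) mpoly \<Rightarrow> bool"
  proof -
    assume f: "f \<in> edge_gens c ?E" and Q: "\<And>a b. {a, b} \<in> ?E \<Longrightarrow> a \<noteq> b \<Longrightarrow> b \<noteq> i \<Longrightarrow> Q (edge_gen c a b)"
    from f obtain a b where ab: "{a, b} \<in> ?E" "f = edge_gen c a b"
      by (auto simp: edge_gens_def)
    then have "a \<noteq> b" using E[of "{a, b}"] by auto
    then show "Q f"
      using Q[of a b] Q[of b a] ab by (cases "b = i") (auto simp: insert_commute edge_gen_commute)
  qed
  have nj: "a \<noteq> j" "b \<noteq> j" if "{a, b} \<in> ?E" for a b
    using that leaf by auto
  have unit: "Poly_Mapping.single 0 c * p \<in> P \<Longrightarrow> p \<in> P" if "p \<in> polys ?V" for p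
  proof -
    assume cp: "Poly_Mapping.single 0 c * p \<in> P"
    have "Poly_Mapping.single 0 (inverse c) * (Poly_Mapping.single 0 c * p) \<in> P"
      using cp by (rule I(4)[OF polys_const])
    moreover have "Poly_Mapping.single 0 (inverse c) * (Poly_Mapping.single 0 c * p) = p"
      using c by (subst mult.assoc[symmetric]) (simp add: mult_single)
    ultimately show "p \<in> P" by (simp only:)
  qed
  consider "indet (X i) \<notin> P" | "indet (Y i) \<notin> P"
    | "indet (X i) \<in> P" "indet (X k) \<in> P" "indet (Y k) \<in> P"
    | "indet (X i) \<in> P" "indet (Y i) \<in> P" "indet (X k) \<notin> P \<or> indet (Y k) \<notin> P"
    by blast
  then show ?thesis
  proof cases
    case 1
    \<comment> \<open>No other edge meets \<open>j\<close>, so the remaining generators are fixed,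
      while the generator of \<open>{i, j}\<close> acquires the \<open>T\<close>-coefficient
      \<open>indet (X i)\<close>, which is outside \<open>P\<close>.\<close>
    let ?t = "\<lambda>v. if v = X j then 1 else 0"
    show ?thesis
    proof (rule smaller_prime_by_deformation[OF P, where t = ?t])
      show "coeff (shift ?t f) m \<in> P" if "f \<in> edge_gens c ?E" for f m
        using that by (rule split) (use nj gP I(2) in \<open>auto simp: shift_edge_gen coeff_pCons split: nat.split\<close>)
      show "edge_gen c i j \<in> P" using gP ij .
      show "coeff (shift ?t (edge_gen c i j)) 1 \<notin> P"
        using 1 ne by (simp add: shift_edge_gen)
    qed (auto intro: pcE)
  next
    case 2
    \<comment> \<open>As before, with \<open>T\<close>-coefficient \<open>c\<close> times
      \<open>indet (Y i)\<close>; since \<open>c\<close> is a unit, this is outside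
      \<open>P\<close>.\<close>
    let ?t = "\<lambda>v. if v = Y j then 1 else 0"
    show ?thesis
    proof (rule smaller_prime_by_deformation[OF P, where t = ?t])
      show "coeff (shift ?t f) m \<in> P" if "f \<in> edge_gens c ?E" for f m
        using that by (rule split) (use nj gP I(2) in \<open>auto simp: shift_edge_gen coeff_pCons split: nat.split\<close>)
      show "edge_gen c i j \<in> P" using gP ij .
      show "coeff (shift ?t (edge_gen c i j)) 1 \<notin> P"
        using 2 ne ijn unit[of "indet (Y i)"] by (auto simp: shift_edge_gen)
    qed (auto intro: pcE)
  next
    case 3
    \<comment> \<open>Now \<open>indet (X i)\<close> itself is the witness, with
      \<open>T\<close>-coefficient 1. The only remaining generator that can move is that of
      \<open>{i, k}\<close>, and it moves by \<open>T * indet (X k)\<close>, which is in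
      \<open>P[T]\<close>.\<close>
    let ?t = "\<lambda>v. if v = X i then 1 else 0"
    show ?thesis
    proof (rule smaller_prime_by_deformation[OF P, where t = ?t])
      show "coeff (shift ?t f) m \<in> P" if "f \<in> edge_gens c ?E" for f m
        using that
      proof (rule split)
        fix a b assume ab: "{a, b} \<in> ?E" "a \<noteq> b" "b \<noteq> i"
        have "a = i \<Longrightarrow> b = k" using ab k(2)[of "{a, b}"] by (auto simp: doubleton_eq_iff)
        then show "coeff (shift ?t (edge_gen c a b)) m \<in> P"
          using ab 3 gP I(2) by (auto simp: shift_edge_gen coeff_pCons split: nat.split)
      qed
      show "indet (X i) \<in> P" using 3 by simp
      show "coeff (shift ?t (indet (X i))) 1 \<notin> P"
        using Pi by (simp add: shift_simps)
    qed (auto intro: pcE)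
  next
    case 4
    \<comment> \<open>The direction \<open>(c y_k, - x_k)\<close> is orthogonal to
      \<open>(x_k, y_k)\<close> for the form \<open>x x' + c y y'\<close>, so a generator of
      \<open>{i, k}\<close> does not change at all. Since \<open>x_k\<close> or \<open>y_k\<close>
      is outside \<open>P\<close>, one of \<open>y_i\<close> and \<open>x_i\<close> leaves
      \<open>P[T]\<close>.\<close>
    let ?t = "\<lambda>v. if v = X i then Poly_Mapping.single 0 c * indet (Y k)
      else if v = Y i then - indet (X k) else 0"
    have A: "coeff (shift ?t f) m \<in> P" if "f \<in> edge_gens c ?E" for f m
      using that
    proof (rule split)
      fix a b assume ab: "{a, b} \<in> ?E" "a \<noteq> b" "b \<noteq> i"
      have "a = i \<Longrightarrow> b = k" using ab k(2)[of "{a, b}"] by (auto simp: doubleton_eq_iff)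
      then show "coeff (shift ?t (edge_gen c a b)) m \<in> P"
        using ab gP I(2) by (auto simp: shift_edge_gen coeff_pCons algebra_simps split: nat.split)
    qed
    have t: "?t v \<in> polys ?V" if "v \<in> ?V" for v
      using k(1) by auto
    from 4(3) show ?thesis
    proof
      assume "indet (X k) \<notin> P"
      then have "- indet (X k) \<notin> P" using I(5)[of 0 "- indet (X k)"] I(2) by auto
      then have "coeff (shift ?t (indet (Y i))) 1 \<notin> P"
        by (simp add: shift_simps)
      then show ?thesis
        using smaller_prime_by_deformation[where t = ?t, OF P t pcE A 4(2)] by blast
    next
      assume "indet (Y k) \<notin> P"
      then have "coeff (shift ?t (indet (X i))) 1 \<notin> P"
        using k(1) unit[of "indet (Y k)"] by (auto simp: shift_simps)
      then show ?thesis
        using smaller_prime_by_deformation[where t = ?t, OF P t pcE A 4(1)] by blast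
    qed
  qed
qed

section \<open>Height and algebraic independence\<close>

text \<open>Scaling by constants makes polynomials a vector space; spans and the exchange lemma
  serve both the dimension count for algebraic independence and the count of minimal
  generators.\<close>

interpretation mpoly: vector_space "\<lambda>(a::'k::field) (p::('v, 'k) mpoly). Poly_Mapping.single 0 a * p"
  by standard (simp_all add: distrib_left distrib_right single_add mult.assoc[symmetric] mult_single)

section \<open>Algebraic independence modulo an ideal\<close>

definition list_monom :: "'a::comm_monoid_mult list \<Rightarrow> nat list \<Rightarrow> 'a" where
  "list_monom zs ms = prod_list (map2 (^) zs ms)"

lemma list_monom_simps [simp]:
  "list_monom [] ms = 1" "list_monom (z # zs) (m # ms) = z ^ m * list_monom zs ms"
  by (simp_all add: list_monom_def)

text \<open>For an ideal \<open>P\<close>: the residues of \<open>zs\<close> are algebraically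
  independent over the field. A polynomial in them is encoded by a finite set of exponent lists with
  coefficients.\<close>

definition alg_indep_mod :: "('v, 'k::field) mpoly set \<Rightarrow> ('v, 'k) mpoly list \<Rightarrow> bool" where
  "alg_indep_mod P zs \<longleftrightarrow> (\<forall>M c. finite M \<longrightarrow> (\<forall>ms\<in>M. length ms = length zs) \<longrightarrow>
     (\<Sum>ms\<in>M. Poly_Mapping.single 0 (c ms) * list_monom zs ms) \<in> P \<longrightarrow> (\<forall>ms\<in>M. c ms = 0))"

lemma alg_indep_modD:
  "alg_indep_mod P zs \<Longrightarrow> finite M \<Longrightarrow> (\<And>ms. ms \<in> M \<Longrightarrow> length ms = length zs) \<Longrightarrow>
    (\<Sum>ms\<in>M. Poly_Mapping.single 0 (c ms) * list_monom zs ms) \<in> P \<Longrightarrow> ms \<in> M \<Longrightarrow> c ms = 0"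
  unfolding alg_indep_mod_def by blast

lemma alg_indep_mod_antimono:
  assumes "alg_indep_mod Q zs" "P \<subseteq> Q"
  shows "alg_indep_mod P zs"
  unfolding alg_indep_mod_def
proof (intro allI impI ballI)
  fix M c ms
  assume "finite M" "\<forall>ms\<in>M. length ms = length zs" "ms \<in> M"
    "(\<Sum>ms\<in>M. Poly_Mapping.single 0 (c ms) * list_monom zs ms) \<in> P"
  then show "c ms = 0"
    using alg_indep_modD[OF assms(1), of M c ms] assms(2) by blast
qed

lemma list_monom_polys: "set zs \<subseteq> polys V \<Longrightarrow> list_monom zs ms \<in> polys V"
proof (induction zs arbitrary: ms)
  case (Cons z zs)
  then show ?case by (cases ms) (auto simp: list_monom_def)
qed simp

text \<open>Given a nontrivial relation modulo \<open>P\<close>, divide it by the highest power of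
  \<open>f\<close> dividing all its terms, which is allowed since \<open>P\<close> is prime and
  misses \<open>f\<close>. Modulo \<open>Q\<close> the terms still containing \<open>f\<close>
  vanish, and the others form a nontrivial relation among \<open>zs\<close>.\<close>

lemma alg_indep_mod_Cons:
  fixes f :: "('v, 'k::field) mpoly"
  assumes P: "primeideal P (poly_ring V)" and Q: "ideal Q (poly_ring V)" and PQ: "P \<subseteq> Q"
    and f: "f \<in> Q" "f \<notin> P" and zs: "set zs \<subseteq> polys V" and ind: "alg_indep_mod Q zs"
  shows "alg_indep_mod P (f # zs)"
  unfolding alg_indep_mod_def
proof (intro allI impI, rule ccontr)
  fix M :: "nat list set" and c
  assume fin: "finite M" and len: "\<forall>ms\<in>M. length ms = length (f # zs)"
    and sum: "(\<Sum>ms\<in>M. Poly_Mapping.single 0 (c ms) * list_monom (f # zs) ms) \<in> P"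
    and "\<not> (\<forall>ms\<in>M. c ms = 0)"
  let ?C = "\<lambda>ms. Poly_Mapping.single (0 :: 'v \<Rightarrow>\<^sub>0 nat) (c ms)"
  define N where "N = {ms \<in> M. c ms \<noteq> 0}"
  have N: "finite N" "N \<noteq> {}"
    using fin \<open>\<not> (\<forall>ms\<in>M. c ms = 0)\<close> by (auto simp: N_def)
  \<comment> \<open>The head of an exponent list is the exponent of \<open>f\<close>, and
    \<open>N\<close> keeps the terms with nonzero coefficient, so \<open>f ^ r\<close> can be
    divided out.\<close>
  define r where "r = Min (hd ` N)"
  have r_le: "r \<le> hd ms" if "ms \<in> N" for ms
    using that N by (simp add: r_def)
  have "r \<in> hd ` N" unfolding r_def using N by (intro Min_in) auto
  then obtain ms0 where ms0: "ms0 \<in> N" "hd ms0 = r" by auto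
  have lenN: "length ms = Suc (length zs)" if "ms \<in> N" for ms
    using that len by (auto simp: N_def)
  have hdtl: "ms = hd ms # tl ms" if "ms \<in> N" for ms
    using lenN[OF that] by (cases ms) auto
  have fV: "f \<in> polys V" using f ideal_poly_ringD(1)[OF Q] by auto
  let ?g = "\<lambda>ms. ?C ms * (f ^ (hd ms - r) * list_monom zs (tl ms))"
  have "(\<Sum>ms\<in>M. ?C ms * list_monom (f # zs) ms) = (\<Sum>ms\<in>N. ?C ms * list_monom (f # zs) ms)"
    unfolding N_def using fin by (intro sum.mono_neutral_right) auto
  also have "\<dots> = f ^ r * sum ?g N"
    unfolding sum_distrib_left
  proof (rule sum.cong[OF refl])
    fix ms assume ms: "ms \<in> N"
    have "list_monom (f # zs) ms = f ^ hd ms * list_monom zs (tl ms)"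
      by (subst hdtl[OF ms]) simp
    also have "f ^ hd ms = f ^ r * f ^ (hd ms - r)"
      using r_le[OF ms] by (simp add: power_add[symmetric])
    finally show "?C ms * list_monom (f # zs) ms = f ^ r * ?g ms"
      by (simp add: ac_simps)
  qed
  finally have "f ^ r * sum ?g N \<in> P" using sum by simp
  moreover have "sum ?g N \<in> polys V"
    by (rule polys_sum) (use fV list_monom_polys[OF zs] in simp)
  ultimately have "sum ?g N \<in> P"
    using prime_power_mem[OF P fV _ _ f(2)] by blast
  then have gQ: "sum ?g N \<in> Q" using PQ by auto
  \<comment> \<open>These are the terms free of \<open>f\<close> after the division. There is at
    least one, \<open>ms0\<close>, and its coefficient yields the contradiction.\<close>
  define R where "R = {ms \<in> N. hd ms = r}"
  have "sum ?g (N - R) \<in> Q"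
  proof (rule ideal_sum[OF Q])
    fix ms assume "ms \<in> N - R"
    then have "hd ms - r > 0" using r_le[of ms] by (auto simp: R_def)
    then obtain k where k: "hd ms - r = Suc k" using gr0_implies_Suc by blast
    have "(?C ms * (f ^ k * list_monom zs (tl ms))) * f \<in> Q"
      by (rule ideal_poly_ringD(4)[OF Q _ f(1)]) (use fV list_monom_polys[OF zs] in simp)
    then show "?g ms \<in> Q" by (simp add: k ac_simps)
  qed
  moreover have "sum ?g N = sum ?g R + sum ?g (N - R)"
    using N(1) by (subst sum.subset_diff[of R]) (auto simp: R_def)
  ultimately have "sum ?g R \<in> Q"
    using ideal_poly_ringD(5)[OF Q gQ, of "sum ?g (N - R)"] by simp
  also have "sum ?g R = (\<Sum>ms\<in>tl ` R. Poly_Mapping.single 0 (c (r # ms)) * list_monom zs ms)"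
  proof (subst sum.reindex)
    show "inj_on tl R"
      using hdtl by (intro inj_onI) (metis (mono_tags, lifting) R_def mem_Collect_eq)
    show "sum ?g R = sum ((\<lambda>ms. Poly_Mapping.single 0 (c (r # ms)) * list_monom zs ms) \<circ> tl) R"
    proof (rule sum.cong[OF refl])
      fix ms assume "ms \<in> R"
      then have "hd ms = r" "ms = r # tl ms"
        using hdtl[of ms] by (auto simp: R_def)
      then show "?g ms = ((\<lambda>ms. Poly_Mapping.single 0 (c (r # ms)) * list_monom zs ms) \<circ> tl) ms"
        by (metis (no_types, lifting) comp_apply diff_self_eq_0 mult_1 power_0)
    qed
  qed
  finally have mem: "(\<Sum>ms\<in>tl ` R. Poly_Mapping.single 0 (c (r # ms)) * list_monom zs ms) \<in> Q" .
  have R0: "ms0 \<in> R" "finite R" using ms0 N by (auto simp: R_def)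
  have "c (r # tl ms0) = 0"
    by (rule alg_indep_modD[OF ind _ _ mem]) (use R0 lenN in \<open>auto simp: R_def\<close>)
  then show False
    using ms0 hdtl[of ms0] by (simp add: N_def)
qed

text \<open>Descending the chain, each strict inclusion supplies an element of the larger prime
  outside the smaller one, which is prepended to the independent list.\<close>

lemma alg_indep_mod_chain:
  fixes Q :: "nat \<Rightarrow> ('v, 'k::field) mpoly set"
  assumes "\<And>i. i \<le> k \<Longrightarrow> primeideal (Q i) (poly_ring V)" "\<And>i. i < k \<Longrightarrow> Q i \<subset> Q (Suc i)"
    and "set zs \<subseteq> polys V" "alg_indep_mod (Q k) zs"
  shows "\<exists>zs'. length zs' = k + length zs \<and> set zs' \<subseteq> polys V \<and> alg_indep_mod (Q 0) zs'"
  using assms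
proof (induction k arbitrary: zs)
  case (Suc k)
  obtain f where f: "f \<in> Q (Suc k)" "f \<notin> Q k" using Suc.prems(2)[of k] by auto
  have i: "ideal (Q (Suc k)) (poly_ring V)"
    using Suc.prems(1) primeideal_imp_ideal by auto
  have "alg_indep_mod (Q k) (f # zs)"
    using alg_indep_mod_Cons[OF Suc.prems(1)[of k] i _ f Suc.prems(3,4)] Suc.prems(2)[of k] by auto
  moreover have "set (f # zs) \<subseteq> polys V" using f ideal_poly_ringD(1)[OF i] Suc.prems(3) by auto
  ultimately show ?case
    using Suc.IH[of "f # zs"] Suc.prems(1,2) by auto
qed auto

section \<open>Counting monomials with bounded exponents\<close>

definition exp_box :: "'v set \<Rightarrow> nat \<Rightarrow> ('v \<Rightarrow>\<^sub>0 nat) set" where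
  "exp_box V b = {m. Poly_Mapping.keys m \<subseteq> V \<and> (\<forall>v. Poly_Mapping.lookup m v \<le> b)}"

text \<open>Exponents restricted to \<open>V\<close> embed the box into the functions from
  \<open>V\<close> to \<open>{..b}\<close>.\<close>

lemma exp_box_card:
  assumes "finite V"
  shows "finite (exp_box V b) \<and> card (exp_box V b) \<le> (b + 1) ^ card V"
proof -
  let ?F = "\<lambda>m. restrict (Poly_Mapping.lookup m) V"
  have inj: "inj_on ?F (exp_box V b)"
  proof (rule inj_onI, rule poly_mapping_eqI)
    fix m m' v assume m: "m \<in> exp_box V b" "m' \<in> exp_box V b" "?F m = ?F m'"
    show "Poly_Mapping.lookup m v = Poly_Mapping.lookup m' v"
    proof (cases "v \<in> V")
      case True
      then show ?thesis using m(3) by (metis restrict_apply')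
    next
      case False
      then have "v \<notin> Poly_Mapping.keys m" "v \<notin> Poly_Mapping.keys m'"
        using m by (auto simp: exp_box_def)
      then show ?thesis by (simp add: in_keys_iff)
    qed
  qed
  have im: "?F ` exp_box V b \<subseteq> Pi\<^sub>E V (\<lambda>_. {..b})"
    by (auto simp: exp_box_def)
  have fin: "finite (Pi\<^sub>E V (\<lambda>_. {..b}))" using assms by (intro finite_PiE) auto
  have "card (exp_box V b) \<le> card (Pi\<^sub>E V (\<lambda>_. {..b}))"
    using card_inj_on_le[OF inj im fin] .
  then show ?thesis
    using inj_on_finite[OF inj im fin] assms by (simp add: card_PiE)
qed

definition box_polys :: "'v set \<Rightarrow> nat \<Rightarrow> ('v, 'k::field) mpoly set" where
  "box_polys V b = {p. Poly_Mapping.keys p \<subseteq> exp_box V b}"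

lemma box_polys_mono: "a \<le> b \<Longrightarrow> box_polys V a \<subseteq> box_polys V b"
proof -
  assume "a \<le> b"
  then have "exp_box V a \<subseteq> exp_box V b"
    unfolding exp_box_def using order_trans by blast
  then show ?thesis by (auto simp: box_polys_def)
qed

lemma box_polys_mult:
  "p \<in> box_polys V a \<Longrightarrow> q \<in> box_polys V b \<Longrightarrow> p * q \<in> box_polys V (a + b)"
proof -
  assume p: "p \<in> box_polys V a" and q: "q \<in> box_polys V b"
  have "m + m' \<in> exp_box V (a + b)" if "m \<in> exp_box V a" "m' \<in> exp_box V b" for m m'
    using that Poly_Mapping.keys_add[of m m'] by (auto simp: exp_box_def lookup_add intro!: add_mono)
  then have "{m + m' | m m'. m \<in> Poly_Mapping.keys p \<and> m' \<in> Poly_Mapping.keys q} \<subseteq> exp_box V (a + b)"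
    using p q unfolding box_polys_def by blast
  then show ?thesis
    using keys_mult[of p q] unfolding box_polys_def by blast
qed

lemma box_polys_one: "1 \<in> box_polys V b"
  by (simp add: box_polys_def exp_box_def)

lemma box_polys_power: "p \<in> box_polys V b \<Longrightarrow> p ^ n \<in> box_polys V (b * n)"
proof (induction n)
  case (Suc n)
  then show ?case using box_polys_mult[of p V b "p ^ n" "b * n"] by simp
qed (simp add: box_polys_one)

lemma box_polys_list_monom:
  "set zs \<subseteq> box_polys V D \<Longrightarrow> list_monom zs ms \<in> box_polys V (D * sum_list ms)"
proof (induction zs arbitrary: ms)
  case (Cons z zs)
  show ?case
  proof (cases ms)
    case (Cons m ms')
    then show ?thesis
      using Cons.IH[of ms'] Cons.prems box_polys_mult[OF box_polys_power, of z V D "list_monom zs ms'" _ m]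
      by (auto simp: distrib_left)
  qed (simp add: list_monom_def box_polys_one)
qed (simp add: box_polys_one)

lemma box_polys_exist:
  assumes "p \<in> polys V"
  shows "\<exists>D. p \<in> box_polys V D"
proof -
  let ?S = "(\<Union>m\<in>Poly_Mapping.keys p. Poly_Mapping.lookup m ` Poly_Mapping.keys m)"
  have fin: "finite ?S" by auto
  have le: "Poly_Mapping.lookup m v \<le> Max (insert 0 ?S)" if "m \<in> Poly_Mapping.keys p" for m v
  proof (cases "v \<in> Poly_Mapping.keys m")
    case True
    then show ?thesis using that fin by (intro Max_ge) auto
  qed (simp add: in_keys_iff)
  have "p \<in> box_polys V (Max (insert 0 ?S))"
    using le assms by (auto simp: box_polys_def exp_box_def mem_polys_iff)
  then show ?thesis ..
qed

lemma box_polys_exist_list: "set zs \<subseteq> polys V \<Longrightarrow> \<exists>D. set zs \<subseteq> box_polys V D"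
proof (induction zs)
  case (Cons z zs)
  then obtain D D' where "set zs \<subseteq> box_polys V D" "z \<in> box_polys V D'"
    using box_polys_exist[of z V] by auto
  then have "set (z # zs) \<subseteq> box_polys V (D + D')"
    using box_polys_mono[of D "D + D'" V] box_polys_mono[of D' "D + D'" V] by auto
  then show ?case ..
qed simp

lemma box_polys_span:
  assumes "p \<in> box_polys V b"
  shows "p \<in> mpoly.span ((\<lambda>m. Poly_Mapping.single m 1) ` exp_box V b)"
proof -
  have "(\<Sum>m\<in>Poly_Mapping.keys p. Poly_Mapping.single m (Poly_Mapping.lookup p m)) \<in>
      mpoly.span ((\<lambda>m. Poly_Mapping.single m 1) ` exp_box V b)"
  proof (rule mpoly.span_sum)
    fix m assume "m \<in> Poly_Mapping.keys p"
    then have "Poly_Mapping.single m 1 \<in> (\<lambda>m. Poly_Mapping.single m (1::'b)) ` exp_box V b"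
      using assms by (auto simp: box_polys_def)
    from mpoly.span_scale[OF mpoly.span_base[OF this], of "Poly_Mapping.lookup p m"]
    show "Poly_Mapping.single m (Poly_Mapping.lookup p m) \<in>
        mpoly.span ((\<lambda>m. Poly_Mapping.single m 1) ` exp_box V b)"
      by (simp add: mult_single)
  qed
  then show ?thesis
    by (subst poly_mapping_decompose)
qed

text \<open>The monomials of exponent less than \<open>d\<close> in more than \<open>|V|\<close> polynomials are more numerous,
  for large \<open>d\<close>, than the monomials in the variables \<open>V\<close> that can occur in them.\<close>

lemma alg_indep_length_le:
  fixes zs :: "('v, 'k::field) mpoly list"
  assumes V: "finite V" and zs: "set zs \<subseteq> polys V" and ind: "alg_indep_mod {0} zs"
  shows "length zs \<le> card V"
proof (rule ccontr)
  define L where "L = length zs"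
  define N where "N = card V"
  assume "\<not> ?thesis"
  then have LN: "Suc N \<le> L" by (simp add: L_def N_def)
  obtain D where D: "set zs \<subseteq> box_polys V D"
    using box_polys_exist_list[OF zs] by auto
  \<comment> \<open>Chosen so that \<open>d ^ N * (D * L + 1) ^ N < d ^ Suc N\<close>, which is the
    final contradiction.\<close>
  define d where "d = (D * L + 1) ^ N + 1"
  define M where "M = {ms. set ms \<subseteq> {..<d} \<and> length ms = L}"
  have finM: "finite M" and cardM: "card M = d ^ L"
    unfolding M_def by (simp_all add: finite_lists_length_eq card_lists_length_eq)
  have inj: "inj_on (list_monom zs) M"
  proof (rule inj_onI, rule ccontr)
    fix a b assume ab: "a \<in> M" "b \<in> M" "list_monom zs a = list_monom zs b" "a \<noteq> b"
    \<comment> \<open>Two distinct exponent lists with the same monomial would give a relation with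
      coefficients 1 and -1.\<close>
    let ?c = "\<lambda>ms. if ms = a then 1 else - 1 :: 'k"
    have "?c a = 0"
      by (rule alg_indep_modD[OF ind, of "{a, b}"])
        (use ab in \<open>auto simp: M_def L_def single_uminus\<close>)
    then show False by simp
  qed
  have indep: "\<not> mpoly.dependent (list_monom zs ` M)"
  proof
    assume "mpoly.dependent (list_monom zs ` M)"
    then obtain u where u: "\<exists>v\<in>list_monom zs ` M. u v \<noteq> 0"
        "(\<Sum>v\<in>list_monom zs ` M. Poly_Mapping.single 0 (u v) * v) = 0"
      using finM by (auto simp: mpoly.dependent_finite)
    from u(2) have "(\<Sum>ms\<in>M. Poly_Mapping.single 0 (u (list_monom zs ms)) * list_monom zs ms) \<in> {0}"
      by (simp add: sum.reindex[OF inj])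
    then have "u (list_monom zs ms) = 0" if "ms \<in> M" for ms
      using alg_indep_modD[OF ind finM, of "\<lambda>ms. u (list_monom zs ms)"] that
      by (auto simp: M_def L_def)
    then show False using u(1) by auto
  qed
  \<comment> \<open>A monomial with exponent list in \<open>M\<close> has at most
    \<open>L * d\<close> factors, each with exponents at most \<open>D\<close>.\<close>
  define b where "b = D * (L * d)"
  have sum_le: "sum_list ms \<le> L * d" if "ms \<in> M" for ms
    using that sum_list_mono[of ms "\<lambda>x. x" "\<lambda>_. d"]
    by (force simp: M_def sum_list_triv)
  have sub: "list_monom zs ` M \<subseteq> mpoly.span ((\<lambda>m. Poly_Mapping.single m 1) ` exp_box V b)"
  proof
    fix p assume "p \<in> list_monom zs ` M"
    then obtain ms where ms: "ms \<in> M" "p = list_monom zs ms" by auto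
    have "p \<in> box_polys V b"
      using box_polys_list_monom[OF D, of ms] box_polys_mono[of "D * sum_list ms" b V] sum_le[OF ms(1)] ms
      by (auto simp: b_def)
    then show "p \<in> mpoly.span ((\<lambda>m. Poly_Mapping.single m 1) ` exp_box V b)"
      by (rule box_polys_span)
  qed
  have box: "finite (exp_box V b)" "card (exp_box V b) \<le> (b + 1) ^ N"
    using exp_box_card[OF V] by (auto simp: N_def)
  have "d ^ L = card (list_monom zs ` M)"
    using cardM card_image[OF inj] by simp
  also have "\<dots> \<le> card ((\<lambda>m. Poly_Mapping.single m (1::'k)) ` exp_box V b)"
    using mpoly.independent_span_bound[OF finite_imageI[OF box(1)] indep sub] by auto
  also have "\<dots> \<le> card (exp_box V b)"
    by (rule card_image_le[OF box(1)])
  also have "\<dots> \<le> (b + 1) ^ N" by (rule box(2))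
  \<comment> \<open>Here \<open>b + 1 = D * L * d + 1\<close>, and the extra 1 is at most
    \<open>d\<close>.\<close>
  also have "\<dots> \<le> (d * (D * L + 1)) ^ N"
    by (rule power_mono) (auto simp: b_def d_def algebra_simps)
  also have "\<dots> = d ^ N * (D * L + 1) ^ N" by (rule power_mult_distrib)
  also have "\<dots> < d ^ N * d" by (simp add: d_def)
  also have "\<dots> = d ^ Suc N" by simp
  also have "\<dots> \<le> d ^ L" using LN by (intro power_increasing) (auto simp: d_def)
  finally show False by simp
qed

text \<open>A chain of length \<open>k\<close> ending in \<open>P\<close> enlarges \<open>zs\<close>
  to \<open>k + length zs\<close> polynomials that are independent modulo zero, and there are at
  most \<open>card V\<close> of those.\<close>

lemma prime_height_le:
  fixes P :: "('v, 'k::field) mpoly set"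
  assumes V: "finite V" and zs: "set zs \<subseteq> polys V" and ind: "alg_indep_mod P zs"
  shows "prime_height (poly_ring V) P \<le> enat (card V - length zs)"
  unfolding prime_height_def
proof (rule Sup_least, clarify)
  fix k and Q :: "nat \<Rightarrow> ('v, 'k) mpoly set"
  assume Q: "\<forall>i\<le>k. primeideal (Q i) (poly_ring V)" "\<forall>i<k. Q i \<subset> Q (Suc i)" "P = Q k"
  obtain zs' where zs': "length zs' = k + length zs" "set zs' \<subseteq> polys V" "alg_indep_mod (Q 0) zs'"
    using alg_indep_mod_chain[of k Q V zs] Q zs ind by auto
  have "primeideal (Q 0) (poly_ring V)" using Q(1) by simp
  from ideal_poly_ringD(2)[OF primeideal_imp_ideal[OF this]] have "0 \<in> Q 0" .
  then have "alg_indep_mod {0} zs'"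
    using alg_indep_mod_antimono[OF zs'(3)] by simp
  then have "length zs' \<le> card V"
    by (rule alg_indep_length_le[OF V zs'(2)])
  then show "enat k \<le> enat (card V - length zs)"
    using zs'(1) by simp
qed

section \<open>Toric primes\<close>

interpretation const_mpoly: coeff_hom "Poly_Mapping.single (0::'w \<Rightarrow>\<^sub>0 nat) :: 'k::field \<Rightarrow> _"
  by standard (simp_all add: single_add mult_single)

abbreviation subst_mpoly :: "('v \<Rightarrow> ('w, 'k::field) mpoly) \<Rightarrow> ('v, 'k) mpoly \<Rightarrow> ('w, 'k) mpoly" where
  "subst_mpoly \<equiv> insertion (Poly_Mapping.single 0)"

definition subst_kernel ::
    "'v set \<Rightarrow> ('v \<Rightarrow> ('w, 'k::field) mpoly) \<Rightarrow> ('v, 'k) mpoly set" where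
  "subst_kernel V s = {f \<in> polys V. subst_mpoly s f = 0}"

text \<open>The target ring is a domain; the linear order on its variables induces one on monomials,
  which excludes zero divisors.\<close>

lemma subst_kernel_prime:
  fixes s :: "'v \<Rightarrow> ('w::linorder, 'k::field) mpoly"
  shows "primeideal (subst_kernel V s) (poly_ring V)"
  unfolding primeideal_poly_ring_iff ideal_poly_ring_iff subst_kernel_def
  by (auto simp: const_mpoly.insertion_add const_mpoly.insertion_mult
      const_mpoly.insertion_zero const_mpoly.insertion_one)

section \<open>Independence of monomials through triangular exponents\<close>

definition lin_comb :: "('w \<Rightarrow>\<^sub>0 nat) list \<Rightarrow> nat list \<Rightarrow> 'w \<Rightarrow>\<^sub>0 nat" where
  "lin_comb ws ms = sum_list (map2 (\<lambda>w m. \<Sum>i<m. w) ws ms)"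

lemma lin_comb_simps [simp]:
  "lin_comb [] ms = 0" "lin_comb (w # ws) (m # ms) = (\<Sum>i<m. w) + lin_comb ws ms"
  by (simp_all add: lin_comb_def)

text \<open>Echelon form: each exponent vector has a pivot variable \<open>u\<close> that is absent
  from all later vectors.\<close>

fun triangular :: "('w \<Rightarrow>\<^sub>0 nat) list \<Rightarrow> bool" where
  "triangular [] \<longleftrightarrow> True"
| "triangular (w # ws) \<longleftrightarrow> triangular ws \<and>
    (\<exists>u. Poly_Mapping.lookup w u \<noteq> 0 \<and> (\<forall>w'\<in>set ws. Poly_Mapping.lookup w' u = 0))"

lemma lookup_lin_comb_eq_0:
  "length ms = length ws \<Longrightarrow> (\<And>w. w \<in> set ws \<Longrightarrow> Poly_Mapping.lookup w u = 0) \<Longrightarrow>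
    Poly_Mapping.lookup (lin_comb ws ms) u = 0"
  by (induction ms ws rule: list_induct2) (simp_all add: lookup_add lookup_sum)

text \<open>At the pivot of the first vector only that vector contributes, so the first
  multiplicities agree; cancel it and recurse.\<close>

lemma triangular_lin_comb_inj:
  assumes "triangular ws" "length a = length ws" "length b = length ws" "lin_comb ws a = lin_comb ws b"
  shows "a = b"
  using assms
proof (induction ws arbitrary: a b)
  case (Cons w ws)
  obtain x a' where a: "a = x # a'" "length a' = length ws" using Cons.prems(2) by (cases a) auto
  obtain y b' where b: "b = y # b'" "length b' = length ws" using Cons.prems(3) by (cases b) auto
  obtain u where u: "Poly_Mapping.lookup w u \<noteq> 0" "\<And>w'. w' \<in> set ws \<Longrightarrow> Poly_Mapping.lookup w' u = 0"
    using Cons.prems(1) by auto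
  have "Poly_Mapping.lookup (lin_comb (w # ws) a) u = Poly_Mapping.lookup (lin_comb (w # ws) b) u"
    using Cons.prems(4) by simp
  then have "x = y"
    using u a b by (simp add: lookup_add lookup_sum lookup_lin_comb_eq_0)
  then show ?case
    using Cons.IH[of a' b'] Cons.prems a b by auto
qed auto

lemma single_power: "Poly_Mapping.single w (1::'k::field) ^ m = Poly_Mapping.single (\<Sum>i<m. w) 1"
  for w :: "'w \<Rightarrow>\<^sub>0 nat"
  by (induction m) (simp_all add: mult_single add.commute)

text \<open>Distinct monomials in \<open>zs\<close> are sent to distinct monomials, so nothing
  cancels in the image of a relation: the coefficient at \<open>lin_comb ws ms0\<close> is just
  \<open>c ms0\<close>.\<close>

lemma alg_indep_mod_subst_kernel:
  fixes zs :: "('v, 'k::field) mpoly list" and s :: "'v \<Rightarrow> ('w, 'k) mpoly"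
  assumes zw: "list_all2 (\<lambda>z w. subst_mpoly s z = Poly_Mapping.single w 1) zs ws"
    and tri: "triangular ws"
  shows "alg_indep_mod (subst_kernel V s) zs"
  unfolding alg_indep_mod_def
proof (intro allI impI ballI)
  fix M c ms0
  assume M: "finite M" "\<forall>ms\<in>M. length ms = length zs" "ms0 \<in> M"
    and sum: "(\<Sum>ms\<in>M. Poly_Mapping.single 0 (c ms) * list_monom zs ms) \<in> subst_kernel V s"
  have len: "length ws = length zs" using zw by (simp add: list_all2_lengthD)
  have mon: "length ms = length zs \<Longrightarrow>
      subst_mpoly s (list_monom zs ms) = Poly_Mapping.single (lin_comb ws ms) 1" for ms
    using zw
  proof (induction zs ws arbitrary: ms rule: list_all2_induct)
    case (Cons z zs w ws)
    then show ?case
      by (cases ms) (auto simp: const_mpoly.insertion_mult const_mpoly.insertion_power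
          single_power mult_single)
  qed (simp add: const_mpoly.insertion_one)
  have "0 = subst_mpoly s (\<Sum>ms\<in>M. Poly_Mapping.single 0 (c ms) * list_monom zs ms)"
    using sum by (simp add: subst_kernel_def)
  also have "\<dots> = (\<Sum>ms\<in>M. Poly_Mapping.single (lin_comb ws ms) (c ms))"
    using M(2) by (simp add: const_mpoly.insertion_sum const_mpoly.insertion_mult
        const_mpoly.insertion_const mon mult_single)
  finally have "0 = Poly_Mapping.lookup (\<Sum>ms\<in>M. Poly_Mapping.single (lin_comb ws ms) (c ms)) (lin_comb ws ms0)"
    by simp
  also have "\<dots> = (\<Sum>ms\<in>M. if ms = ms0 then c ms else 0)"
    unfolding lookup_sum
  proof (rule sum.cong[OF refl])
    fix ms assume "ms \<in> M"
    then show "Poly_Mapping.lookup (Poly_Mapping.single (lin_comb ws ms) (c ms)) (lin_comb ws ms0) =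
        (if ms = ms0 then c ms else 0)"
      using triangular_lin_comb_inj[OF tri, of ms ms0] M len by (auto simp: lookup_single when_def)
  qed
  also have "\<dots> = c ms0" using M by simp
  finally show "c ms0 = 0" by simp
qed

lemma triangular_append:
  assumes "distinct xs" "triangular ws"
    and "\<And>x. x \<in> set xs \<Longrightarrow> Poly_Mapping.lookup (f x) (u x) \<noteq> 0"
    and "\<And>x y. x \<in> set xs \<Longrightarrow> y \<in> set xs \<Longrightarrow> x \<noteq> y \<Longrightarrow> Poly_Mapping.lookup (f y) (u x) = 0"
    and "\<And>x w. x \<in> set xs \<Longrightarrow> w \<in> set ws \<Longrightarrow> Poly_Mapping.lookup w (u x) = 0"
  shows "triangular (map f xs @ ws)"
  using assms
proof (induction xs)
  case (Cons x xs)
  have "triangular (map f xs @ ws)" using Cons by simp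
  moreover have "\<forall>w'\<in>set (map f xs @ ws). Poly_Mapping.lookup w' (u x) = 0"
    using Cons.prems by auto
  ultimately show ?case using Cons.prems(3)[of x] by auto
qed simp

lemma card_graph_vars: "finite (graph_vars n)" "card (graph_vars n) = 2 * n"
proof -
  show "finite (graph_vars n)" by (simp add: graph_vars_def)
  have "card (graph_vars n) = card (X ` {1..n}) + card (Y ` {1..n})"
    unfolding graph_vars_def by (rule card_Un_disjoint) auto
  then show "card (graph_vars n) = 2 * n"
    by (simp add: card_image inj_on_def)
qed

text \<open>The prime ideal is the kernel of a parametrization: the vertices in \<open>S\<close> go to zero, and
  for the remaining vertices the vector \<open>(x, y)\<close>, rotated on one side of the bipartition, is a
  multiple \<open>s\<^sub>i\<close> of the vector \<open>(1, b)\<close> with \<open>b\<close> depending only on the class of the vertex. The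
  parameters \<open>s\<^sub>i\<close> and \<open>b\<close> are the variables with even and odd index, respectively.\<close>

lemma small_prime:
  fixes c :: "'k::field" and r :: "nat \<Rightarrow> nat"
  assumes c: "c \<noteq> 0" and S: "S \<subseteq> {1..n}"
    and bip: "\<And>i j. {i, j} \<in> E \<Longrightarrow> i \<in> A \<longleftrightarrow> j \<notin> A"
    and E: "\<And>e. e \<in> E \<Longrightarrow> e \<subseteq> {1..n}"
    and r: "\<And>i j. {i, j} \<in> E \<Longrightarrow> i \<notin> S \<Longrightarrow> j \<notin> S \<Longrightarrow> r i = r j"
  shows "\<exists>P. primeideal P (poly_ring (graph_vars n)) \<and> edge_gens c E \<subseteq> P \<and>
    prime_height (poly_ring (graph_vars n)) P \<le> enat (n + card S - card (r ` ({1..n} - S)))"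
proof -
  define s :: "nat \<Rightarrow> (nat, 'k) mpoly" where "s = (\<lambda>i. indet (2 * i))"
  define b :: "nat \<Rightarrow> (nat, 'k) mpoly" where "b = (\<lambda>q. indet (2 * q + 1))"
  \<comment> \<open>For an edge with \<open>i\<close> in \<open>A\<close>, \<open>j\<close> outside
    \<open>A\<close>, both outside \<open>S\<close> and in class \<open>q\<close>, the generator
    becomes \<open>s i * (- c * s j * b q) + c * (s i * b q) * s j = 0\<close>; an end in
    \<open>S\<close> makes both products vanish.\<close>
  define \<sigma> where "\<sigma> = (\<lambda>v. case v of
      X i \<Rightarrow> if i \<in> S then 0 else if i \<in> A then s i else - (Poly_Mapping.single 0 c * (s i * b (r i)))
    | Y i \<Rightarrow> if i \<in> S then 0 else if i \<in> A then s i * b (r i) else s i)"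
  let ?V = "graph_vars n" and ?W = "{1..n} - S"
  let ?P = "subst_kernel ?V \<sigma>"
  note subst = const_mpoly.insertion_add const_mpoly.insertion_mult
      const_mpoly.insertion_indet const_mpoly.insertion_const
  have gen: "subst_mpoly \<sigma> (edge_gen c i j) = 0" if "{i, j} \<in> E" for i j
    using bip[OF that] r[OF that] by (simp add: edge_gen_def subst \<sigma>_def algebra_simps)
  have sub: "edge_gens c E \<subseteq> ?P"
    using gen edge_gens_polys[of E n c, OF E] unfolding subst_kernel_def edge_gens_def by blast
  \<comment> \<open>At a representative of each class, the coordinate not taken by \<open>zv\<close>
    detects the class parameter \<open>b q\<close>.\<close>
  define rep where "rep = (\<lambda>q. SOME i. i \<in> ?W \<and> r i = q)"
  have rep: "rep q \<in> ?W" "r (rep q) = q" if "q \<in> r ` ?W" for q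
  proof -
    have "\<exists>i. i \<in> ?W \<and> r i = q" using that by blast
    from someI_ex[OF this] show "rep q \<in> ?W" "r (rep q) = q" unfolding rep_def by blast+
  qed
  define L where "L = sorted_list_of_set ?W"
  define C where "C = sorted_list_of_set (r ` ?W)"
  have LC: "set L = ?W" "distinct L" "length L = card ?W"
      "set C = r ` ?W" "distinct C" "length C = card (r ` ?W)"
    by (simp_all add: L_def C_def)
  define zv where "zv = (\<lambda>i. if i \<in> A then indet (X i) else indet (Y i) :: (var, 'k) mpoly)"
  \<comment> \<open>The factor \<open>d\<close> cancels the \<open>- c\<close> in the image of
    \<open>X (rep q)\<close>, so that \<open>zc q\<close> maps to a monomial with coefficient
    1.\<close>
  obtain d where d: "d * c = - 1"
    using c that[of "- inverse c"] by simp
  define zc where "zc = (\<lambda>q. if rep q \<in> A then indet (Y (rep q))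
      else Poly_Mapping.single 0 d * indet (X (rep q)) :: (var, 'k) mpoly)"
  define wv :: "nat \<Rightarrow> nat \<Rightarrow>\<^sub>0 nat" where "wv = (\<lambda>i. Poly_Mapping.single (2 * i) 1)"
  define wc :: "nat \<Rightarrow> nat \<Rightarrow>\<^sub>0 nat" where
    "wc = (\<lambda>q. Poly_Mapping.single (2 * rep q) 1 + Poly_Mapping.single (2 * q + 1) 1)"
  have zv: "subst_mpoly \<sigma> (zv i) = Poly_Mapping.single (wv i) 1" if "i \<in> ?W" for i
    using that by (simp add: zv_def wv_def subst \<sigma>_def s_def indet_def[of "2 * i"])
  have zc: "subst_mpoly \<sigma> (zc q) = Poly_Mapping.single (wc q) 1" if "q \<in> r ` ?W" for q
    using rep[OF that] c
    by (simp add: zc_def wc_def subst \<sigma>_def s_def b_def indet_def[of "_ :: nat"])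
      (simp add: mult_single single_uminus d)
  \<comment> \<open>The class monomials come first: they also contain \<open>s (rep q)\<close>, but
    their odd pivots \<open>2 * q + 1\<close> occur in no vertex monomial.\<close>
  let ?zs = "map zc C @ map zv L" and ?ws = "map wc C @ map wv L"
  have zw: "list_all2 (\<lambda>z w. subst_mpoly \<sigma> z = Poly_Mapping.single w 1) ?zs ?ws"
    using zv zc LC by (auto intro!: list_all2_appendI simp: list_all2_map1 list_all2_map2 list_all2_same)
  have even_odd: "2 * q + 1 \<noteq> 2 * (i::nat)" "Suc (2 * q) \<noteq> 2 * (i::nat)" for q i
    by presburger+
  have "triangular (map wv L @ [])"
    by (rule triangular_append[where u = "\<lambda>i. 2 * i"])
      (use LC in \<open>auto simp: wv_def lookup_single\<close>)
  then have "triangular ?ws"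
    by (intro triangular_append[where u = "\<lambda>q. 2 * q + 1"])
      (use LC even_odd even_odd[symmetric] in \<open>auto simp: wv_def wc_def lookup_single lookup_add when_def\<close>)
  with zw have "alg_indep_mod ?P ?zs"
    by (rule alg_indep_mod_subst_kernel)
  moreover have "set ?zs \<subseteq> polys ?V"
    using LC rep by (auto simp: zv_def zc_def)
  ultimately have "prime_height (poly_ring ?V) ?P \<le> enat (card ?V - length ?zs)"
    by (intro prime_height_le) (auto simp: card_graph_vars)
  also have "card ?V - length ?zs = n + card S - card (r ` ?W)"
  proof -
    have "card ?W = n - card S" "card S \<le> n"
      using S card_mono[OF _ S] by (auto simp: card_Diff_subset finite_subset)
    then show ?thesis by (simp add: card_graph_vars LC)
  qed
  finally show ?thesis
    using subst_kernel_prime sub by blast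
qed

section \<open>Disjoint unions of paths\<close>

lemma path_edges_simps [simp]:
  "path_edges [] = {}" "path_edges [v] = {}"
  "path_edges (u # v # vs) = insert {u, v} (path_edges (v # vs))"
proof -
  show "path_edges (u # v # vs) = insert {u, v} (path_edges (v # vs))"
  proof
    show "path_edges (u # v # vs) \<subseteq> insert {u, v} (path_edges (v # vs))"
    proof
      fix e assume "e \<in> path_edges (u # v # vs)"
      then obtain i where i: "e = {(u # v # vs) ! i, (u # v # vs) ! Suc i}" "Suc i < length (u # v # vs)"
        unfolding path_edges_def by blast
      then show "e \<in> insert {u, v} (path_edges (v # vs))"
        by (cases i) (auto simp: path_edges_def)
    qed
    have "{(v # vs) ! i, (v # vs) ! Suc i} \<in> path_edges (u # v # vs)" if "Suc i < length (v # vs)" for i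
      unfolding path_edges_def using that by (auto intro!: exI[of _ "Suc i"])
    moreover have "{u, v} \<in> path_edges (u # v # vs)"
      unfolding path_edges_def by (auto intro!: exI[of _ 0])
    ultimately show "insert {u, v} (path_edges (v # vs)) \<subseteq> path_edges (u # v # vs)"
      unfolding path_edges_def[of "v # vs"] by blast
  qed
qed (simp_all add: path_edges_def)

lemma path_edges_append:
  "p \<noteq> [] \<Longrightarrow> q \<noteq> [] \<Longrightarrow> path_edges (p @ q) = insert {last p, hd q} (path_edges p \<union> path_edges q)"
proof (induction p)
  case (Cons a p)
  then show ?case
    by (cases p; cases q) auto
qed simp

lemma path_edges_rev: "path_edges (rev p) = path_edges p"
proof (induction p)
  case (Cons a p)
  then show ?case
    using path_edges_append[of "rev p" "[a]"] path_edges_append[of "[a]" p]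
    by (cases "p = []") (simp_all add: last_rev insert_commute)
qed simp

lemma path_edges_subset: "e \<in> path_edges p \<Longrightarrow> e \<subseteq> set p"
  by (auto simp: path_edges_def)

text \<open>The condition inside \<open>disjoint_union_of_paths\<close> with its witness exposed, so
  that the number of paths can be tracked.\<close>

definition path_cover :: "nat \<Rightarrow> nat set set \<Rightarrow> nat list set \<Rightarrow> bool" where
  "path_cover n E Ps \<longleftrightarrow>
      (\<forall>vs \<in> Ps. vs \<noteq> [] \<and> distinct vs) \<and>
      pairwise (\<lambda>vs ws. disjnt (set vs) (set ws)) Ps \<and>
      (\<Union>vs \<in> Ps. set vs) = {1..n} \<and>
      (\<Union>vs \<in> Ps. path_edges vs) = E"

lemma disjoint_union_of_paths_iff: "disjoint_union_of_paths n E \<longleftrightarrow> (\<exists>Ps. path_cover n E Ps)"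
  by (simp add: disjoint_union_of_paths_def path_cover_def)

lemma path_coverD:
  assumes "path_cover n E Ps"
  shows "vs \<in> Ps \<Longrightarrow> vs \<noteq> []" "vs \<in> Ps \<Longrightarrow> distinct vs"
    "vs \<in> Ps \<Longrightarrow> ws \<in> Ps \<Longrightarrow> v \<in> set vs \<Longrightarrow> v \<in> set ws \<Longrightarrow> vs = ws"
    "vs \<in> Ps \<Longrightarrow> set vs \<subseteq> {1..n}" "v \<in> {1..n} \<Longrightarrow> \<exists>vs\<in>Ps. v \<in> set vs"
    "vs \<in> Ps \<Longrightarrow> path_edges vs \<subseteq> E" "e \<in> E \<Longrightarrow> \<exists>vs\<in>Ps. e \<in> path_edges vs"
proof -
  note a = assms[unfolded path_cover_def]
  show "vs \<in> Ps \<Longrightarrow> vs \<noteq> []" "vs \<in> Ps \<Longrightarrow> distinct vs" "vs \<in> Ps \<Longrightarrow> set vs \<subseteq> {1..n}"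
    "vs \<in> Ps \<Longrightarrow> path_edges vs \<subseteq> E" "e \<in> E \<Longrightarrow> \<exists>vs\<in>Ps. e \<in> path_edges vs"
    using a by blast+
  show "v \<in> {1..n} \<Longrightarrow> \<exists>vs\<in>Ps. v \<in> set vs" using a by blast
  show "vs \<in> Ps \<Longrightarrow> ws \<in> Ps \<Longrightarrow> v \<in> set vs \<Longrightarrow> v \<in> set ws \<Longrightarrow> vs = ws"
    using a unfolding pairwise_def disjnt_def by blast
qed

lemma path_coverI:
  assumes "\<And>vs. vs \<in> Ps \<Longrightarrow> vs \<noteq> []" "\<And>vs. vs \<in> Ps \<Longrightarrow> distinct vs"
    and "\<And>vs ws. vs \<in> Ps \<Longrightarrow> ws \<in> Ps \<Longrightarrow> vs \<noteq> ws \<Longrightarrow> set vs \<inter> set ws = {}"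
    and "(\<Union>vs \<in> Ps. set vs) = {1..n}" "(\<Union>vs \<in> Ps. path_edges vs) = E"
  shows "path_cover n E Ps"
  unfolding path_cover_def pairwise_def disjnt_def
  by (intro conjI ballI impI assms)

text \<open>First vertices serve as representatives of the paths.\<close>

lemma path_cover_hd:
  assumes "path_cover n E Ps"
  shows "inj_on hd Ps" "hd ` Ps \<subseteq> {1..n}" "finite Ps"
proof -
  note D = path_coverD[OF assms]
  show i: "inj_on hd Ps"
  proof (rule inj_onI)
    fix vs ws assume "vs \<in> Ps" "ws \<in> Ps" "hd vs = hd ws"
    then show "vs = ws" using D(3)[of vs ws "hd vs"] D(1) hd_in_set[of vs] hd_in_set[of ws] by simp
  qed
  show h: "hd ` Ps \<subseteq> {1..n}"
  proof
    fix v assume "v \<in> hd ` Ps"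
    then obtain vs where "vs \<in> Ps" "v = hd vs" by auto
    then show "v \<in> {1..n}" using D(1,4)[of vs] hd_in_set[of vs] by blast
  qed
  show "finite Ps"
    using inj_on_finite[OF i h] by simp
qed

text \<open>Take a path with an edge: \<open>j\<close> is its first vertex and \<open>i\<close> its
  second. Removing the edge splits the path into \<open>[j]\<close> and the rest. Besides the leaf,
  this provides the data needed by \<open>leaf_removal_step\<close>.\<close>

lemma leaf_exists:
  assumes "disjoint_union_of_paths n E" "E \<noteq> {}"
  obtains i j k where "{i, j} \<in> E" "\<And>e. e \<in> E \<Longrightarrow> j \<in> e \<Longrightarrow> e = {i, j}"
    "k \<in> {1..n}" "\<And>e. e \<in> E \<Longrightarrow> i \<in> e \<Longrightarrow> e = {i, j} \<or> e = {i, k}"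
    "disjoint_union_of_paths n (E - {{i, j}})"
proof -
  obtain Ps where Ps: "path_cover n E Ps"
    using assms by (auto simp: disjoint_union_of_paths_iff)
  note D = path_coverD[OF Ps]
  obtain vs where vs: "vs \<in> Ps" "path_edges vs \<noteq> {}"
    using assms(2) D(7) by blast
  obtain j i ws where jiw: "vs = j # i # ws"
    using vs(2) by (metis path_edges_simps(1,2) neq_Nil_conv)
  have dis: "distinct (j # i # ws)" using D(2) vs jiw by blast
  have own: "e \<in> path_edges vs" if e: "e \<in> E" "v \<in> e" "v \<in> set vs" for e v
  proof -
    obtain us where us: "us \<in> Ps" "e \<in> path_edges us" using D(7) e by blast
    then have "us = vs" using D(3)[OF us(1) vs(1), of v] e path_edges_subset by blast
    then show ?thesis using us by simp
  qed
  \<comment> \<open>The third vertex of the path. If there is none, \<open>{i, j}\<close> is the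
    only edge at \<open>i\<close>, and the value \<open>i\<close> is a mere placeholder in
    \<open>{1..n}\<close>.\<close>
  define k where "k = (if ws = [] then i else hd ws)"
  have e_iw: "e = {i, k}" if "e \<in> path_edges (i # ws)" "i \<in> e" for e
    using that dis path_edges_subset[of e ws] by (cases ws) (auto simp: k_def)
  have ji: "{i, j} \<notin> path_edges (i # ws)"
    using dis path_edges_subset by force
  define Ps' where "Ps' = insert [j] (insert (i # ws) (Ps - {vs}))"
  have disj: "set us \<inter> set vs = {}" if "us \<in> Ps - {vs}" for us
    using that vs D(3) by blast
  have "path_cover n (E - {{i, j}}) Ps'"
  proof (rule path_coverI)
    show "us \<noteq> []" "distinct us" if "us \<in> Ps'" for us
      using that dis D(1,2) by (auto simp: Ps'_def)
    show "set us \<inter> set us' = {}" if "us \<in> Ps'" "us' \<in> Ps'" "us \<noteq> us'" for us us'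
      using that dis disj D(3) unfolding Ps'_def jiw by (auto; blast)
    have "(\<Union>us \<in> Ps'. set us) = (\<Union>us \<in> insert vs (Ps - {vs}). set us)"
      by (auto simp: Ps'_def jiw)
    also have "insert vs (Ps - {vs}) = Ps" using vs by auto
    finally show "(\<Union>us \<in> Ps'. set us) = {1..n}" using Ps by (simp add: path_cover_def)
    have "(\<Union>us \<in> Ps. path_edges us) = (\<Union>us \<in> Ps - {vs}. path_edges us) \<union> path_edges vs"
      using vs(1) by auto
    then have "E = (\<Union>us \<in> Ps - {vs}. path_edges us) \<union> insert {i, j} (path_edges (i # ws))"
      using Ps by (simp add: path_cover_def jiw insert_commute)
    moreover have "{i, j} \<notin> path_edges us" if "us \<in> Ps - {vs}" for us
      using disj[OF that] path_edges_subset[of "{i, j}" us] by (auto simp: jiw)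
    ultimately show "(\<Union>us \<in> Ps'. path_edges us) = E - {{i, j}}"
      using ji by (auto simp: Ps'_def)
  qed
  then have "disjoint_union_of_paths n (E - {{i, j}})"
    by (auto simp: disjoint_union_of_paths_iff)
  moreover have "{i, j} \<in> E"
    using D(6)[OF vs(1)] by (simp add: jiw insert_commute)
  moreover have "e = {i, j}" if "e \<in> E" "j \<in> e" for e
    using own[OF that] dis that path_edges_subset[of e "i # ws"] by (auto simp: jiw insert_commute)
  moreover have "e = {i, j} \<or> e = {i, k}" if "e \<in> E" "i \<in> e" for e
    using own[OF that] e_iw that by (auto simp: jiw insert_commute)
  moreover have "k \<in> {1..n}"
    using D(4)[OF vs(1)] by (cases ws) (auto simp: k_def jiw)
  ultimately show ?thesis using that by blast
qed

text \<open>The edges to the predecessor and to the successor differ because the vertices are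
  distinct. Under a degree bound of two, a new edge can thus only attach at ends of paths.\<close>

lemma path_vertex_degree:
  assumes "distinct p" "i \<in> set p" "i \<noteq> hd p" "i \<noteq> last p"
  shows "\<exists>e e'. e \<in> path_edges p \<and> e' \<in> path_edges p \<and> e \<noteq> e' \<and> i \<in> e \<and> i \<in> e'"
proof -
  obtain us ws where p: "p = us @ i # ws"
    using assms(2) split_list by fast
  have ne: "us \<noteq> []" "ws \<noteq> []" using assms p by auto
  have "{last us, i} \<in> path_edges p" "{i, hd ws} \<in> path_edges p"
    using ne unfolding p by (auto simp: path_edges_append neq_Nil_conv)
  moreover have "last us \<noteq> hd ws" "last us \<noteq> i"
    using assms(1) ne unfolding p by (auto dest: last_in_set hd_in_set)
  ultimately show ?thesis
    by (intro exI[of _ "{last us, i}"] exI[of _ "{i, hd ws}"]) (auto simp: doubleton_eq_iff)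
qed

section \<open>Vertex classes constant along edges\<close>

lemma merge_classes:
  fixes r :: "nat \<Rightarrow> nat"
  assumes "finite W" "\<And>a b. {a, b} \<in> E \<Longrightarrow> r a = r b"
  shows "\<exists>r' :: nat \<Rightarrow> nat. (\<forall>a b. {a, b} \<in> insert {i, j} E \<longrightarrow> r' a = r' b) \<and> card (r ` W) \<le> card (r' ` W) + 1"
proof -
  \<comment> \<open>The class of \<open>j\<close> is merged into that of \<open>i\<close>, so at
    most the value \<open>r j\<close> is lost.\<close>
  define r' where "r' = (\<lambda>v. if r v = r j then r i else r v)"
  have "r ` W - {r j} \<subseteq> r' ` W"
    by (auto simp: r'_def image_iff)
  then have "card (r ` W - {r j}) \<le> card (r' ` W)"
    using assms(1) by (intro card_mono) auto
  moreover have "card (r ` W) \<le> card (r ` W - {r j}) + 1"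
    by (simp add: card_Diff_singleton_if) linarith
  ultimately have "card (r ` W) \<le> card (r' ` W) + 1" by linarith
  moreover have "r' a = r' b" if "{a, b} \<in> insert {i, j} E" for a b
    using assms(2)[of a b] that by (auto simp: r'_def doubleton_eq_iff)
  ultimately show ?thesis by blast
qed

text \<open>Start from the identity, where every vertex is its own class; each edge merges two
  classes and costs at most one.\<close>

lemma class_map_exists:
  assumes "finite E" "finite W" "\<And>e. e \<in> E \<Longrightarrow> card e = 2"
  shows "\<exists>r :: nat \<Rightarrow> nat. (\<forall>a b. {a, b} \<in> E \<longrightarrow> r a = r b) \<and> card W \<le> card (r ` W) + card E"
  using assms(1,3)
proof (induction E rule: finite_induct)
  case empty
  show ?case by (intro exI[of _ "\<lambda>v. v"]) auto
next
  case (insert e E)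
  obtain r :: "nat \<Rightarrow> nat" where r: "\<forall>a b. {a, b} \<in> E \<longrightarrow> r a = r b" "card W \<le> card (r ` W) + card E"
    using insert by auto
  obtain i j where e: "e = {i, j}" using insert.prems[of e] by (auto simp: card_2_iff)
  obtain r' :: "nat \<Rightarrow> nat" where r': "\<forall>a b. {a, b} \<in> insert {i, j} E \<longrightarrow> r' a = r' b" "card (r ` W) \<le> card (r' ` W) + 1"
    using merge_classes[OF assms(2), of E r i j] r(1) by blast
  have "card W \<le> card (r' ` W) + card (insert e E)"
    using r(2) r'(2) insert.hyps by simp
  with r'(1) show ?case
    unfolding e by blast
qed

text \<open>Adding edges one at a time, either an edge joins the ends of two different paths, or it closes a
  cycle and so does not lower the number of classes.\<close>

lemma paths_or_many_classes:
  fixes E :: "nat set set"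
  assumes "finite E" "\<And>e. e \<in> E \<Longrightarrow> e \<subseteq> {1..n} \<and> card e = 2" "\<And>v. card {e \<in> E. v \<in> e} \<le> 2"
  shows "(\<exists>r :: nat \<Rightarrow> nat. (\<forall>a b. {a, b} \<in> E \<longrightarrow> r a = r b) \<and> n < card (r ` {1..n}) + card E) \<or>
    (\<exists>Ps. path_cover n E Ps \<and> card Ps + card E = n)"
  using assms
proof (induction E rule: finite_induct)
  case empty
  have "path_cover n {} ((\<lambda>v. [v]) ` {1..n})"
    by (rule path_coverI) auto
  moreover have "card ((\<lambda>v. [v]) ` {1..n}) = n"
    by (simp add: card_image inj_on_def)
  ultimately show ?case by fastforce
next
  case (insert e E)
  have finI: "finite {e' \<in> insert e E. v \<in> e'}" for v using insert.hyps by simp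
  have "card {e \<in> E. v \<in> e} \<le> 2" for v
  proof -
    have "card {e' \<in> E. v \<in> e'} \<le> card {e' \<in> insert e E. v \<in> e'}"
      by (rule card_mono[OF finI]) auto
    then show ?thesis using insert.prems(2)[of v] by linarith
  qed
  then consider r :: "nat \<Rightarrow> nat" where "\<forall>a b. {a, b} \<in> E \<longrightarrow> r a = r b" "n < card (r ` {1..n}) + card E"
    | Ps where "path_cover n E Ps" "card Ps + card E = n"
    using insert.IH insert.prems(1) by blast
  moreover obtain i j where e: "e = {i, j}" "i \<noteq> j" "i \<in> {1..n}" "j \<in> {1..n}"
    using insert.prems(1)[of e] by (auto simp: card_2_iff)
  moreover have cardE: "card (insert e E) = card E + 1" using insert.hyps by simp
  ultimately show ?case
  proof cases
    case 1
    \<comment> \<open>The strict surplus persists: at most one class is lost while one edge is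
      gained.\<close>
    obtain r' :: "nat \<Rightarrow> nat" where "\<forall>a b. {a, b} \<in> insert {i, j} E \<longrightarrow> r' a = r' b"
        "card (r ` {1..n}) \<le> card (r' ` {1..n}) + 1"
      using merge_classes[of "{1..n}" E r i j] 1(1) by blast
    moreover from this have "n < card (r' ` {1..n}) + card (insert e E)"
      using 1(2) cardE by linarith
    ultimately show ?thesis unfolding e(1) by blast
  next
    case (2 Ps)
    note D = path_coverD[OF 2(1)]
    note H = path_cover_hd[OF 2(1)]
    obtain p q where p: "p \<in> Ps" "i \<in> set p" and q: "q \<in> Ps" "j \<in> set q"
      using D(5) e(3,4) by blast
    show ?thesis
    proof (cases "p = q")
      case True
      \<comment> \<open>The new edge stays within one path, so the paths, represented by their
        heads, remain the classes. There are at least \<open>n - card E\<close> of them, and the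
        additional edge makes the inequality strict.\<close>
      define r where "r = (\<lambda>v. hd (THE vs. vs \<in> Ps \<and> v \<in> set vs))"
      have r: "r v = hd vs" if "vs \<in> Ps" "v \<in> set vs" for v vs
      proof -
        have "(THE vs. vs \<in> Ps \<and> v \<in> set vs) = vs"
          using that D(3) by (intro the_equality) blast+
        then show ?thesis by (simp add: r_def)
      qed
      have "hd ` Ps \<subseteq> r ` {1..n}"
      proof
        fix h assume "h \<in> hd ` Ps"
        then obtain vs where vs: "vs \<in> Ps" "h = hd vs" by auto
        then have "h \<in> set vs" using D(1) by auto
        then have "h \<in> {1..n}" "h = r h" using r[OF vs(1), of h] vs(2) D(4)[OF vs(1)] by auto
        then show "h \<in> r ` {1..n}" by (rule rev_image_eqI)
      qed
      then have "card (hd ` Ps) \<le> card (r ` {1..n})"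
        by (intro card_mono) auto
      then have "n < card (r ` {1..n}) + card (insert e E)"
        using 2(2) cardE card_image[OF H(1)] by linarith
      moreover have "r a = r b" if ab: "{a, b} \<in> insert e E" for a b
      proof (cases "{a, b} = e")
        case True
        then show ?thesis using r p q \<open>p = q\<close> e(1) by (auto simp: doubleton_eq_iff)
      next
        case False
        then obtain vs where vs: "vs \<in> Ps" "{a, b} \<in> path_edges vs" using ab D(7) by blast
        then have "a \<in> set vs" "b \<in> set vs" using path_edges_subset by blast+
        then show ?thesis using r vs by metis
      qed
      ultimately show ?thesis by blast
    next
      case False
      \<comment> \<open>An interior vertex already has two edges, so \<open>e\<close> would give it
        degree three.\<close>
      have end_pt: "v = hd vs \<or> v = last vs" if vs: "vs \<in> Ps" "v \<in> set vs" "v \<in> e" for v vs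
      proof (rule ccontr)
        assume "\<not> ?thesis"
        then obtain e1 e2 where e12: "e1 \<in> path_edges vs" "e2 \<in> path_edges vs" "e1 \<noteq> e2" "v \<in> e1" "v \<in> e2"
          using path_vertex_degree[OF D(2)[OF vs(1)] vs(2)] by blast
        then have E12: "e1 \<in> E" "e2 \<in> E" using D(6)[OF vs(1)] by auto
        then have "{e, e1, e2} \<subseteq> {e' \<in> insert e E. v \<in> e'}" using e12 vs by auto
        from card_mono[OF finI this] have "card {e, e1, e2} \<le> card {e' \<in> insert e E. v \<in> e'}" .
        moreover have "card {e, e1, e2} = 3" using E12 e12 insert.hyps by (auto simp: card_insert_if)
        ultimately show False using insert.prems(2)[of v] by linarith
      qed
      \<comment> \<open>Orient both paths so that \<open>p'\<close> ends in \<open>i\<close> and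
        \<open>q'\<close> begins with \<open>j\<close>; the new edge then joins them into
        \<open>p' @ q'\<close>.\<close>
      define p' where "p' = (if i = last p then p else rev p)"
      define q' where "q' = (if j = hd q then q else rev q)"
      have p': "p' \<noteq> []" "set p' = set p" "distinct p'" "last p' = i" "path_edges p' = path_edges p"
        using D(1,2)[OF p(1)] end_pt[OF p] e(1) by (auto simp: p'_def path_edges_rev last_rev)
      have q': "q' \<noteq> []" "set q' = set q" "distinct q'" "hd q' = j" "path_edges q' = path_edges q"
        using D(1,2)[OF q(1)] end_pt[OF q] e(1) by (auto simp: q'_def path_edges_rev hd_rev)
      define Ps' where "Ps' = insert (p' @ q') (Ps - {p, q})"
      have disj: "set us \<inter> set p = {}" "set us \<inter> set q = {}" if "us \<in> Ps - {p, q}" for us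
        using that p(1) q(1) D(3) by blast+
      have pq: "set p \<inter> set q = {}" using D(3)[OF p(1) q(1)] False by blast
      have Ps_eq: "Ps = insert p (insert q (Ps - {p, q}))" using p q by auto
      have "path_cover n (insert e E) Ps'"
      proof (rule path_coverI)
        show "us \<noteq> []" "distinct us" if "us \<in> Ps'" for us
          using that D(1,2) p' q' pq by (auto simp: Ps'_def)
        show "set us \<inter> set us' = {}" if us: "us \<in> Ps'" "us' \<in> Ps'" "us \<noteq> us'" for us us'
        proof -
          have "set us \<inter> set us' = {}" if "us \<in> Ps - {p, q}" "us' \<in> Ps - {p, q}"
            using that us(3) D(3) by blast
          moreover have "set ws \<inter> set (p' @ q') = {}" if "ws \<in> Ps - {p, q}" for ws
            using disj[OF that] p' q' by auto
          ultimately show ?thesis using us unfolding Ps'_def by blast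
        qed
        have "(\<Union>vs \<in> Ps'. set vs) = (\<Union>vs \<in> Ps. set vs)"
          by (subst Ps_eq) (auto simp: Ps'_def p' q')
        then show "(\<Union>vs \<in> Ps'. set vs) = {1..n}" using 2(1) by (simp add: path_cover_def)
        have "(\<Union>vs \<in> Ps'. path_edges vs) = insert e (\<Union>vs \<in> Ps. path_edges vs)"
          by (subst Ps_eq) (auto simp: Ps'_def p' q' path_edges_append e(1))
        then show "(\<Union>vs \<in> Ps'. path_edges vs) = insert e E" using 2(1) by (simp add: path_cover_def)
      qed
      moreover have "card Ps' + card (insert e E) = n"
      proof -
        have "p' @ q' \<notin> Ps - {p, q}"
        proof
          assume "p' @ q' \<in> Ps - {p, q}"
          from disj(1)[OF this] have "set p' = {}" using p'(2) by auto
          then show False using p'(1) by simp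
        qed
        then have "card Ps' = Suc (card (Ps - {p, q}))"
          using H(3) by (simp add: Ps'_def)
        moreover have "card Ps = Suc (Suc (card (Ps - {p, q})))"
          by (subst Ps_eq) (use H(3) False in auto)
        ultimately show ?thesis using 2(2) cardE by linarith
      qed
      ultimately show ?thesis by blast
    qed
  qed
qed

section \<open>Minimal generators of ideals of quadrics\<close>

lemma mon_degree_eq:
  "finite K \<Longrightarrow> Poly_Mapping.keys m \<subseteq> K \<Longrightarrow> mon_degree m = (\<Sum>v\<in>K. Poly_Mapping.lookup m v)"
  unfolding mon_degree_def by (rule sum.mono_neutral_left) (auto simp: in_keys_iff)

lemma mon_degree_add: "mon_degree (m + n) = mon_degree m + mon_degree n"
  using Poly_Mapping.keys_add[of m n]
  by (simp add: mon_degree_eq[of "Poly_Mapping.keys m \<union> Poly_Mapping.keys n"] lookup_add sum.distrib)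

lemma mon_degree_pos: "m \<noteq> 0 \<Longrightarrow> 1 \<le> mon_degree m"
proof -
  assume "m \<noteq> 0"
  then obtain v where "v \<in> Poly_Mapping.keys m" by (metis keys_eq_empty ex_in_conv)
  then have "Poly_Mapping.lookup m v \<noteq> 0" "Poly_Mapping.lookup m v \<le> mon_degree m"
    unfolding mon_degree_def by (auto simp: in_keys_iff intro: member_le_sum)
  then show ?thesis by linarith
qed

text \<open>The \<open>k\<close>-th power of the ideal generated by the variables.\<close>

definition order_ge :: "'v set \<Rightarrow> nat \<Rightarrow> ('v, 'k::field) mpoly set" where
  "order_ge V k = {q \<in> polys V. \<forall>m\<in>Poly_Mapping.keys q. k \<le> mon_degree m}"

definition quadrics :: "'v set \<Rightarrow> ('v, 'k::field) mpoly set" where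
  "quadrics V = {q \<in> polys V. \<forall>m\<in>Poly_Mapping.keys q. mon_degree m = 2}"

lemma order_ge_add: "p \<in> order_ge V k \<Longrightarrow> q \<in> order_ge V k \<Longrightarrow> p + q \<in> order_ge V k"
  unfolding order_ge_def using Poly_Mapping.keys_add[of p q] by auto

lemma order_ge_mult: "p \<in> order_ge V k \<Longrightarrow> q \<in> order_ge V l \<Longrightarrow> p * q \<in> order_ge V (k + l)"
  unfolding order_ge_def using keys_mult[of p q] by (fastforce simp: mon_degree_add intro: add_mono)

lemma order_ge_zero: "0 \<in> order_ge V k"
  by (simp add: order_ge_def)

lemma polys_order_ge: "p \<in> polys V \<Longrightarrow> p \<in> order_ge V 0"
  by (simp add: order_ge_def)

lemma quadrics_order_ge: "quadrics V \<subseteq> order_ge V 2"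
  by (auto simp: quadrics_def order_ge_def)

lemma polys_minus_const: "p \<in> polys V \<Longrightarrow> p - Poly_Mapping.single 0 (Poly_Mapping.lookup p 0) \<in> order_ge V 1"
  unfolding order_ge_def using mon_degree_pos
  by (auto simp: in_keys_iff lookup_minus lookup_single when_def split: if_splits)

lemma span_quadrics: "A \<subseteq> quadrics V \<Longrightarrow> mpoly.span A \<subseteq> quadrics V"
proof (rule mpoly.span_minimal)
  show "mpoly.subspace (quadrics V)"
  proof (rule mpoly.subspaceI)
    show "x + y \<in> quadrics V" if "x \<in> quadrics V" "y \<in> quadrics V" for x y
      using that Poly_Mapping.keys_add[of x y] unfolding quadrics_def by auto
    show "Poly_Mapping.single 0 a * x \<in> quadrics V" if "x \<in> quadrics V" for a x
    proof -
      have "Poly_Mapping.keys (Poly_Mapping.single 0 a * x) \<subseteq> Poly_Mapping.keys x"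
        using keys_mult[of "Poly_Mapping.single 0 a" x] by (auto split: if_splits)
      then show ?thesis using that unfolding quadrics_def by auto
    qed
  qed (simp add: quadrics_def)
qed

text \<open>Modulo terms of degree at least three, a multiplier acts on a quadric through its
  constant coefficient only. Hence the degree-two part of an ideal generated by quadrics is their
  linear span.\<close>

lemma span_plus_cubic_ideal:
  assumes A: "A \<subseteq> quadrics V"
  shows "ideal {g + q | g q. g \<in> mpoly.span A \<and> q \<in> order_ge V 3} (poly_ring V)"
  unfolding ideal_poly_ring_iff
proof (intro conjI ballI)
  let ?T = "{g + q | g q. g \<in> mpoly.span A \<and> q \<in> order_ge V 3}"
  have sp: "g \<in> quadrics V" if "g \<in> mpoly.span A" for g
    using that span_quadrics[OF A] by auto
  have pcs: "g \<in> polys V" "q \<in> polys V" if "g \<in> mpoly.span A" "q \<in> order_ge V 3" for g q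
    using sp[OF that(1)] that(2) by (auto simp: quadrics_def order_ge_def)
  show "?T \<subseteq> polys V" using pcs polys_closed(3) by blast
  show "0 \<in> ?T"
    using mpoly.span_zero[of A] order_ge_zero[of V 3] by (auto intro!: exI[of _ 0])
  show "x + y \<in> ?T" if xy: "x \<in> ?T" "y \<in> ?T" for x y
  proof -
    obtain g q g' q' where *: "x = g + q" "y = g' + q'" "g \<in> mpoly.span A" "g' \<in> mpoly.span A"
        "q \<in> order_ge V 3" "q' \<in> order_ge V 3"
      using xy by auto
    have "x + y = (g + g') + (q + q')" using * by simp
    moreover have "g + g' \<in> mpoly.span A" "q + q' \<in> order_ge V 3"
      using * by (auto intro: mpoly.span_add order_ge_add)
    ultimately show ?thesis by blast
  qed
  show "r * x \<in> ?T" if r: "r \<in> polys V" and x: "x \<in> ?T" for r x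
  proof -
    obtain g q where *: "x = g + q" "g \<in> mpoly.span A" "q \<in> order_ge V 3"
      using x by auto
    define r0 where "r0 = Poly_Mapping.single (0 :: 'a \<Rightarrow>\<^sub>0 nat) (Poly_Mapping.lookup r 0)"
    have "r * x = r0 * g + ((r - r0) * g + r * q)"
      unfolding *(1) by (simp add: algebra_simps)
    moreover have "r0 * g \<in> mpoly.span A"
      unfolding r0_def by (rule mpoly.span_scale[OF *(2)])
    moreover have "(r - r0) * g \<in> order_ge V 3"
      using order_ge_mult[OF polys_minus_const[OF r], of g 2] sp[OF *(2)] quadrics_order_ge
      by (auto simp: r0_def numeral_3_eq_3)
    moreover have "r * q \<in> order_ge V 3"
      using order_ge_mult[OF polys_order_ge[OF r] *(3)] by simp
    ultimately show ?thesis
      using order_ge_add by blast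
  qed
qed

lemma Idl_subset: "ideal J (poly_ring V) \<Longrightarrow> A \<subseteq> J \<Longrightarrow> Idl\<^bsub>poly_ring V\<^esub> A \<subseteq> J"
  by (rule ring.genideal_minimal[OF cring.axioms(1)[OF poly_ring_cring]])

lemma Idl_ideal: "A \<subseteq> polys V \<Longrightarrow> ideal (Idl\<^bsub>poly_ring V\<^esub> A) (poly_ring V)"
  by (rule ring.genideal_ideal[OF cring.axioms(1)[OF poly_ring_cring]])

lemma Idl_self: "A \<subseteq> polys V \<Longrightarrow> A \<subseteq> Idl\<^bsub>poly_ring V\<^esub> A"
  by (rule ring.genideal_self[OF cring.axioms(1)[OF poly_ring_cring]])

lemma span_subset_Idl:
  assumes "A \<subseteq> polys V"
  shows "mpoly.span A \<subseteq> Idl\<^bsub>poly_ring V\<^esub> A"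
proof (rule mpoly.span_minimal[OF Idl_self[OF assms]])
  note D = ideal_poly_ringD[OF Idl_ideal[OF assms]]
  show "mpoly.subspace (Idl\<^bsub>poly_ring V\<^esub> A)"
    by (rule mpoly.subspaceI) (use D(2-4) in auto)
qed

text \<open>The graded Nakayama argument in degree two: a homogeneous generator is either in the
  span of \<open>F\<close> or has order at least three, and generators of the second kind contribute
  nothing to quadrics.\<close>

lemma quadrics_span_of_generators:
  assumes F: "F \<subseteq> quadrics V" and B: "homogeneous_generating_set V (Idl\<^bsub>poly_ring V\<^esub> F) B"
  shows "F \<subseteq> mpoly.span (B \<inter> mpoly.span F)"
proof
  let ?T = "\<lambda>A. {g + q | g q. g \<in> mpoly.span A \<and> q \<in> order_ge V 3}"
  let ?B = "B \<inter> mpoly.span F"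
  fix f assume f: "f \<in> F"
  have FV: "F \<subseteq> polys V" using F by (auto simp: quadrics_def)
  have BV: "B \<subseteq> polys V" and hom: "\<And>b. b \<in> B \<Longrightarrow> homogeneous b"
      and BF: "Idl\<^bsub>poly_ring V\<^esub> B = Idl\<^bsub>poly_ring V\<^esub> F"
    using B by (auto simp: homogeneous_generating_set_def)
  have spF: "mpoly.span F \<subseteq> quadrics V" by (rule span_quadrics[OF F])
  have "F \<subseteq> ?T F"
    using mpoly.span_base[of _ F] order_ge_zero[of V 3] by force
  then have "Idl\<^bsub>poly_ring V\<^esub> F \<subseteq> ?T F"
    by (rule Idl_subset[OF span_plus_cubic_ideal[OF F]])
  then have BT: "B \<subseteq> ?T F" using Idl_self[OF BV] BF by auto
  \<comment> \<open>The two parts of \<open>b\<close> live in different degrees and cannot cancel,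
    so homogeneity forces one of them to be zero.\<close>
  have dich: "b \<in> mpoly.span F \<or> b \<in> order_ge V 3" if b: "b \<in> B" for b
  proof -
    obtain g q where gq: "b = g + q" "g \<in> mpoly.span F" "q \<in> order_ge V 3"
      using BT b by blast
    obtain d where d: "\<And>m. m \<in> Poly_Mapping.keys b \<Longrightarrow> mon_degree m = d"
      using hom[OF b] by (auto simp: homogeneous_def)
    have g2: "mon_degree m = 2" if "m \<in> Poly_Mapping.keys g" for m
      using that gq(2) spF by (auto simp: quadrics_def)
    have q3: "3 \<le> mon_degree m" if "m \<in> Poly_Mapping.keys q" for m
      using that gq(3) by (auto simp: order_ge_def)
    have lookup_b: "Poly_Mapping.lookup b m = Poly_Mapping.lookup g m + Poly_Mapping.lookup q m" for m
      by (simp add: gq(1) lookup_add)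
    show ?thesis
    proof (cases "d = 2")
      case True
      have "m \<notin> Poly_Mapping.keys q" for m
      proof
        assume m: "m \<in> Poly_Mapping.keys q"
        then have "m \<notin> Poly_Mapping.keys g" using g2[of m] q3[of m] by auto
        then have "m \<in> Poly_Mapping.keys b" using m lookup_b[of m] by (simp add: in_keys_iff)
        then show False using d[of m] q3[OF m] True by simp
      qed
      then have "q = 0" by (metis keys_eq_empty ex_in_conv)
      then show ?thesis using gq by simp
    next
      case False
      have "m \<notin> Poly_Mapping.keys g" for m
      proof
        assume m: "m \<in> Poly_Mapping.keys g"
        then have "m \<notin> Poly_Mapping.keys q" using g2[of m] q3[of m] by auto
        then have "m \<in> Poly_Mapping.keys b" using m lookup_b[of m] by (simp add: in_keys_iff)
        then show False using d[of m] g2[OF m] False by simp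
      qed
      then have "g = 0" by (metis keys_eq_empty ex_in_conv)
      then show ?thesis using gq by simp
    qed
  qed
  have BQ: "?B \<subseteq> quadrics V" using spF by auto
  have "B \<subseteq> ?T ?B"
  proof
    fix b assume b: "b \<in> B"
    show "b \<in> ?T ?B"
    proof (cases "b \<in> mpoly.span F")
      case True
      then have "b \<in> mpoly.span ?B" using b by (auto intro: mpoly.span_base)
      then show ?thesis using order_ge_zero[of V 3] by force
    next
      case False
      then show ?thesis using dich[OF b] mpoly.span_zero[of ?B] by force
    qed
  qed
  then have "Idl\<^bsub>poly_ring V\<^esub> B \<subseteq> ?T ?B"
    by (rule Idl_subset[OF span_plus_cubic_ideal[OF BQ]])
  then have "f \<in> ?T ?B" using f Idl_self[OF FV] BF by auto
  then obtain g q where gq: "f = g + q" "g \<in> mpoly.span ?B" "q \<in> order_ge V 3"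
    by blast
  \<comment> \<open>Both \<open>f\<close> and \<open>g\<close> are quadrics, so the part
    \<open>q\<close> of order at least three must vanish.\<close>
  have "m \<notin> Poly_Mapping.keys q" for m
  proof
    assume m: "m \<in> Poly_Mapping.keys q"
    then have d: "3 \<le> mon_degree m" using gq(3) by (auto simp: order_ge_def)
    then have "m \<notin> Poly_Mapping.keys g" "m \<notin> Poly_Mapping.keys f"
      using gq(2) span_quadrics[OF BQ] f F by (auto simp: quadrics_def)
    then show False using m by (simp add: gq(1) in_keys_iff lookup_add)
  qed
  then have "q = 0" by (metis keys_eq_empty ex_in_conv)
  then show "f \<in> mpoly.span ?B" using gq by simp
qed

lemma generating_set_of_span:
  assumes F: "F \<subseteq> quadrics V" and B: "B \<subseteq> mpoly.span F" "F \<subseteq> mpoly.span B"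
  shows "homogeneous_generating_set V (Idl\<^bsub>poly_ring V\<^esub> F) B"
proof -
  have BQ: "B \<subseteq> quadrics V" using B span_quadrics[OF F] by auto
  then have BV: "B \<subseteq> polys V" and FV: "F \<subseteq> polys V" using F by (auto simp: quadrics_def)
  have "Idl\<^bsub>poly_ring V\<^esub> B = Idl\<^bsub>poly_ring V\<^esub> F"
  proof
    show "Idl\<^bsub>poly_ring V\<^esub> B \<subseteq> Idl\<^bsub>poly_ring V\<^esub> F"
      by (rule Idl_subset[OF Idl_ideal[OF FV]]) (use B span_subset_Idl[OF FV] in blast)
    show "Idl\<^bsub>poly_ring V\<^esub> F \<subseteq> Idl\<^bsub>poly_ring V\<^esub> B"
      by (rule Idl_subset[OF Idl_ideal[OF BV]]) (use B span_subset_Idl[OF BV] in blast)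
  qed
  then show ?thesis
    using BQ BV by (auto simp: homogeneous_generating_set_def homogeneous_def quadrics_def)
qed

text \<open>Finite minimal homogeneous generating sets are bases of the span of \<open>F\<close>:
  minimality discards elements outside the span as well as linearly redundant ones. The exchange
  lemma then fixes their cardinality.\<close>

lemma min_num_generators_quadrics:
  assumes F: "F \<subseteq> quadrics V" "finite F" and ind: "\<not> mpoly.dependent F"
  shows "min_num_generators V (Idl\<^bsub>poly_ring V\<^esub> F) = card F"
  unfolding min_num_generators_def
proof (rule the_equality)
  let ?I = "Idl\<^bsub>poly_ring V\<^esub> F"
  have "homogeneous_generating_set V ?I F"
    by (rule generating_set_of_span[OF F(1)]) (auto intro: mpoly.span_base)
  moreover have "\<not> homogeneous_generating_set V ?I B'" if B': "B' \<subset> F" for B'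
  proof
    assume "homogeneous_generating_set V ?I B'"
    from quadrics_span_of_generators[OF F(1) this]
    have sp: "F \<subseteq> mpoly.span B'" using mpoly.span_mono[of "B' \<inter> mpoly.span F" B'] by auto
    obtain f where f: "f \<in> F" "f \<notin> B'" using B' by auto
    then have "B' \<subseteq> F - {f}" using B' by auto
    then have "f \<in> mpoly.span (F - {f})" using sp f mpoly.span_mono by blast
    then show False using ind f by (auto simp: mpoly.dependent_def)
  qed
  ultimately show "\<exists>B. minimal_homogeneous_generating_set V ?I B \<and> finite B \<and> card B = card F"
    using F(2) by (auto simp: minimal_homogeneous_generating_set_def)
  fix k assume "\<exists>B. minimal_homogeneous_generating_set V ?I B \<and> finite B \<and> card B = k"
  then obtain B where B: "homogeneous_generating_set V ?I B"
      "\<And>B'. B' \<subset> B \<Longrightarrow> \<not> homogeneous_generating_set V ?I B'" "finite B" "card B = k"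
    by (auto simp: minimal_homogeneous_generating_set_def)
  have sp: "F \<subseteq> mpoly.span (B \<inter> mpoly.span F)"
    by (rule quadrics_span_of_generators[OF F(1) B(1)])
  then have "homogeneous_generating_set V ?I (B \<inter> mpoly.span F)"
    by (intro generating_set_of_span[OF F(1)]) auto
  then have BF: "B \<inter> mpoly.span F = B"
    using B(2) by blast
  have indB: "\<not> mpoly.dependent B"
  proof
    assume "mpoly.dependent B"
    then obtain b where b: "b \<in> B" "b \<in> mpoly.span (B - {b})" by (auto simp: mpoly.dependent_def)
    have "mpoly.span (insert b (B - {b})) = mpoly.span (B - {b})"
      by (rule mpoly.span_redundant[OF b(2)])
    then have "F \<subseteq> mpoly.span (B - {b})" using sp BF b(1) by (simp add: insert_absorb)
    then have "homogeneous_generating_set V ?I (B - {b})"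
      using BF by (intro generating_set_of_span[OF F(1)]) auto
    then show False using B(2) b(1) by blast
  qed
  have "card B \<le> card F"
    using mpoly.independent_span_bound[OF F(2) indB] BF by auto
  moreover have "card F \<le> card B"
    using mpoly.independent_span_bound[OF B(3) ind] sp BF by auto
  ultimately show "k = card F" using B(4) by simp
qed

section \<open>Complete intersections\<close>

text \<open>Each leaf removal inserts a strictly smaller prime, so the chain is built downwards from
  \<open>P\<close>, one step per edge.\<close>

lemma prime_height_path_cover_ge:
  fixes P :: "(var, 'k::field) mpoly set"
  assumes "disjoint_union_of_paths n E" "finite E" "\<And>e. e \<in> E \<Longrightarrow> e \<subseteq> {1..n} \<and> card e = 2"
    and "primeideal P (poly_ring (graph_vars n))" "edge_gens c E \<subseteq> P" "c \<noteq> 0"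
  shows "enat (card E) \<le> prime_height (poly_ring (graph_vars n)) P"
proof -
  let ?R = "poly_ring (graph_vars n) :: (var, 'k) mpoly ring"
  have "\<exists>Q. (\<forall>i\<le>card E. primeideal (Q i) ?R) \<and> (\<forall>i<card E. Q i \<subset> Q (Suc i)) \<and> Q (card E) = P"
    using assms
  proof (induction "card E" arbitrary: E P)
    case 0
    then show ?case by (intro exI[of _ "\<lambda>_. P"]) auto
  next
    case (Suc k)
    then have "E \<noteq> {}" by auto
    then obtain i j l where leaf: "{i, j} \<in> E" "\<And>e. e \<in> E \<Longrightarrow> j \<in> e \<Longrightarrow> e = {i, j}"
        "l \<in> {1..n}" "\<And>e. e \<in> E \<Longrightarrow> i \<in> e \<Longrightarrow> e = {i, j} \<or> e = {i, l}"
        "disjoint_union_of_paths n (E - {{i, j}})"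
      using leaf_exists[OF Suc.prems(1)] by blast
    obtain P' where P': "primeideal P' ?R" "P' \<subset> P" "edge_gens c (E - {{i, j}}) \<subseteq> P'"
      using leaf_removal_step[OF Suc.prems(4,5,6,3) leaf(1,2,3,4)] by blast
    have k: "k = card (E - {{i, j}})" using Suc.hyps(2) leaf(1) Suc.prems(2) by simp
    obtain Q where Q: "\<forall>i\<le>k. primeideal (Q i) ?R" "\<forall>i<k. Q i \<subset> Q (Suc i)" "Q k = P'"
      using Suc.hyps(1)[OF k leaf(5) _ _ P'(1,3) Suc.prems(6)] Suc.prems(2,3) k by auto
    have "(\<forall>i\<le>Suc k. primeideal ((Q(Suc k := P)) i) ?R) \<and>
        (\<forall>i<Suc k. (Q(Suc k := P)) i \<subset> (Q(Suc k := P)) (Suc i)) \<and> (Q(Suc k := P)) (Suc k) = P"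
      using Q P' Suc.prems(4) by (auto simp: less_Suc_eq le_Suc_eq)
    then show ?case unfolding Suc.hyps(2)[symmetric] by blast
  qed
  then show ?thesis
    unfolding prime_height_def by (intro Sup_upper) blast
qed

section \<open>Linear independence of the edge generators\<close>

lemma keys_pair:
  "Poly_Mapping.keys (Poly_Mapping.single u (1::nat) + Poly_Mapping.single v 1) = {u, v}"
  by (auto simp: in_keys_iff lookup_add lookup_single when_def split: if_splits)

lemma edge_gen_eq_singles:
  "edge_gen c i j = Poly_Mapping.single (Poly_Mapping.single (X i) 1 + Poly_Mapping.single (X j) 1) 1 +
    Poly_Mapping.single (Poly_Mapping.single (Y i) 1 + Poly_Mapping.single (Y j) 1) c"
  by (simp add: edge_gen_def indet_def mult_single)

lemma lookup_edge_gen: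
  assumes "i \<noteq> j" "a \<noteq> b"
  shows "Poly_Mapping.lookup (edge_gen c i j) (Poly_Mapping.single (X a) 1 + Poly_Mapping.single (X b) 1) =
    (if {i, j} = {a, b} then 1 else 0)"
proof -
  let ?m = "\<lambda>u v. Poly_Mapping.single u (1::nat) + Poly_Mapping.single v 1"
  have "?m (X i) (X j) = ?m (X a) (X b) \<longleftrightarrow> {i, j} = {a, b}"
  proof
    assume "?m (X i) (X j) = ?m (X a) (X b)"
    then have "{X i, X j} = {X a, X b}" using keys_pair by metis
    then show "{i, j} = {a, b}" by (auto simp: doubleton_eq_iff)
  qed (auto simp: doubleton_eq_iff add.commute)
  moreover have "?m (Y i) (Y j) \<noteq> ?m (X a) (X b)"
  proof
    assume "?m (Y i) (Y j) = ?m (X a) (X b)"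
    then have "{Y i, Y j} = {X a, X b}" using keys_pair by metis
    then show False by auto
  qed
  ultimately show ?thesis
    by (simp add: edge_gen_eq_singles lookup_add lookup_single when_def)
qed

lemma edge_gen_quadric:
  "i \<in> {1..n} \<Longrightarrow> j \<in> {1..n} \<Longrightarrow> edge_gen c i j \<in> quadrics (graph_vars n)"
proof -
  assume ij: "i \<in> {1..n}" "j \<in> {1..n}"
  have deg: "mon_degree (Poly_Mapping.single u 1 + Poly_Mapping.single v 1) = 2" for u v :: var
    by (simp add: mon_degree_add) (simp add: mon_degree_def)
  have "mon_degree m = 2" if "m \<in> Poly_Mapping.keys (edge_gen c i j)" for m
    using that deg Poly_Mapping.keys_add unfolding edge_gen_eq_singles
    by (fastforce split: if_splits)
  then show ?thesis using edge_gen_polys[OF ij] by (simp add: quadrics_def)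
qed

text \<open>The coefficients at the monomials \<open>x_i x_j\<close> form a family dual to the
  generators: each is 1 on its own edge and 0 on all others. This gives distinctness and
  independence at once.\<close>

lemma edge_gens_independent:
  fixes c :: "'k::field"
  assumes E: "\<And>e. e \<in> E \<Longrightarrow> card e = 2" "finite E"
  shows "finite (edge_gens c E)" "card (edge_gens c E) = card E" "\<not> mpoly.dependent (edge_gens c E)"
proof -
  \<comment> \<open>Ordering the ends by size makes the generator a function of the edge.\<close>
  define g where "g = (\<lambda>e. edge_gen c (Min e) (Max e))"
  have g: "g {i, j} = edge_gen c i j" for i j
    by (cases "i \<le> j") (auto simp: g_def edge_gen_commute)
  have img: "edge_gens c E = g ` E"
  proof
    show "edge_gens c E \<subseteq> g ` E"
    proof
      fix f assume "f \<in> edge_gens c E"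
      then obtain i j where "f = edge_gen c i j" "{i, j} \<in> E" unfolding edge_gens_def by blast
      then show "f \<in> g ` E" using g[of i j] by (intro rev_image_eqI[of "{i, j}"]) simp_all
    qed
    show "g ` E \<subseteq> edge_gens c E"
    proof
      fix f assume "f \<in> g ` E"
      then obtain e where e: "e \<in> E" "f = g e" by auto
      then obtain i j where "e = {i, j}" using E(1)[of e] by (auto simp: card_2_iff)
      then show "f \<in> edge_gens c E" using e g unfolding edge_gens_def by auto
    qed
  qed
  define \<mu> where "\<mu> = (\<lambda>e. Poly_Mapping.single (X (Min e)) (1::nat) + Poly_Mapping.single (X (Max e)) 1)"
  have lk: "Poly_Mapping.lookup (g e) (\<mu> e') = (if e = e' then 1 else 0)" if ee: "e \<in> E" "e' \<in> E" for e e'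
  proof -
    have mm: "Min d \<noteq> Max d \<and> d = {Min d, Max d}" if "d \<in> E" for d :: "nat set"
      using E(1)[OF that] by (auto simp: card_2_iff min_def max_def split: if_splits)
    show ?thesis
      unfolding g_def \<mu>_def
      using lookup_edge_gen[of "Min e" "Max e" "Min e'" "Max e'" c] mm[OF ee(1)] mm[OF ee(2)] by simp
  qed
  have inj: "inj_on g E"
  proof (rule inj_onI)
    fix e e' assume e: "e \<in> E" "e' \<in> E" "g e = g e'"
    then show "e = e'" using lk[of e e'] lk[of e' e'] by (auto split: if_splits)
  qed
  show "finite (edge_gens c E)" "card (edge_gens c E) = card E"
    using img E(2) card_image[OF inj] by auto
  show "\<not> mpoly.dependent (edge_gens c E)"
  proof
    assume "mpoly.dependent (edge_gens c E)"
    then obtain e where e: "e \<in> E" "g e \<in> mpoly.span (g ` E - {g e})"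
      unfolding mpoly.dependent_def img by blast
    have "mpoly.span (g ` E - {g e}) \<subseteq> {p. Poly_Mapping.lookup p (\<mu> e) = 0}"
    proof (rule mpoly.span_minimal)
      show "g ` E - {g e} \<subseteq> {p. Poly_Mapping.lookup p (\<mu> e) = 0}"
        using lk e(1) by auto
      show "mpoly.subspace {p. Poly_Mapping.lookup p (\<mu> e) = (0::'k)}"
        by (rule mpoly.subspaceI)
          (auto simp: lookup_add mult_map_scale_conv_mult[symmetric] Poly_Mapping.map.rep_eq when_def)
    qed
    then show False using e lk[OF e(1) e(1)] by auto
  qed
qed

text \<open>Either all degrees are at most two, and a cycle leaves too many classes with
  \<open>S\<close> empty, or some vertex \<open>v\<close> has degree at least three and
  \<open>S = {v}\<close> is used.\<close>

lemma height_less_if_not_paths: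
  fixes c :: "'k::field"
  assumes G: "simple_graph n E" "\<And>i j. {i, j} \<in> E \<Longrightarrow> i \<in> A \<longleftrightarrow> j \<notin> A" "finite E" "c \<noteq> 0"
    and np: "\<not> disjoint_union_of_paths n E"
  shows "\<exists>P. primeideal P (poly_ring (graph_vars n)) \<and> edge_gens c E \<subseteq> P \<and>
    prime_height (poly_ring (graph_vars n)) P < enat (card E)"
proof -
  have E: "e \<subseteq> {1..n}" "card e = 2" if "e \<in> E" for e
    using G(1) that by (auto simp: simple_graph_def)
  have "\<exists>S r. S \<subseteq> {1..n} \<and> (\<forall>i j. {i, j} \<in> E \<longrightarrow> i \<notin> S \<longrightarrow> j \<notin> S \<longrightarrow> r i = (r j :: nat)) \<and>
      n + card S - card (r ` ({1..n} - S)) < card E"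
  proof (cases "\<forall>v. card {e \<in> E. v \<in> e} \<le> 2")
    case True
    then obtain r :: "nat \<Rightarrow> nat" where r: "\<forall>a b. {a, b} \<in> E \<longrightarrow> r a = r b" "n < card (r ` {1..n}) + card E"
      using paths_or_many_classes[OF G(3), of n] E np disjoint_union_of_paths_iff by blast
    have "card (r ` {1..n}) \<le> n" using card_image_le[of "{1..n}" r] by simp
    then show ?thesis using r by (intro exI[of _ "{}"] exI[of _ r]) auto
  next
    case False
    then obtain v where v: "3 \<le> card {e \<in> E. v \<in> e}" by (metis not_less_eq_eq numeral_2_eq_2 numeral_3_eq_3)
    then have "{e \<in> E. v \<in> e} \<noteq> {}" by (metis card.empty not_numeral_le_zero)
    then have vn: "v \<in> {1..n}" using E by blast
    define E' where "E' = {e \<in> E. v \<notin> e}"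
    have cE: "card E = card E' + card {e \<in> E. v \<in> e}"
    proof -
      have "E = E' \<union> {e \<in> E. v \<in> e}" by (auto simp: E'_def)
      then show ?thesis
        using card_Un_disjoint[of E' "{e \<in> E. v \<in> e}"] G(3) by (auto simp: E'_def)
    qed
    obtain r :: "nat \<Rightarrow> nat" where r: "\<forall>a b. {a, b} \<in> E' \<longrightarrow> r a = r b"
        "card ({1..n} - {v}) \<le> card (r ` ({1..n} - {v})) + card E'"
      using class_map_exists[of E' "{1..n} - {v}"] G(3) E by (auto simp: E'_def)
    have "card ({1..n} - {v}) = n - 1" using vn by simp
    \<comment> \<open>With \<open>n - 1\<close> vertices left, there are at least
      \<open>n - 1 - card E'\<close> classes, so the bound is at most \<open>card E' + 2\<close>,
      while \<open>v\<close> accounts for at least three further edges.\<close>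
    then have "n + card {v} - card (r ` ({1..n} - {v})) < card E"
      using r(2) cE v vn by simp
    moreover have "r i = r j" if "{i, j} \<in> E" "i \<notin> {v}" "j \<notin> {v}" for i j
      using that r(1) by (auto simp: E'_def)
    ultimately show ?thesis using vn by (intro exI[of _ "{v}"] exI[of _ r]) auto
  qed
  then obtain S and r :: "nat \<Rightarrow> nat" where S: "S \<subseteq> {1..n}"
      "\<And>i j. {i, j} \<in> E \<Longrightarrow> i \<notin> S \<Longrightarrow> j \<notin> S \<Longrightarrow> r i = r j"
      "n + card S - card (r ` ({1..n} - S)) < card E"
    by blast
  obtain P :: "(var, 'k) mpoly set" where P: "primeideal P (poly_ring (graph_vars n))" "edge_gens c E \<subseteq> P"
      "prime_height (poly_ring (graph_vars n)) P \<le> enat (n + card S - card (r ` ({1..n} - S)))"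
    using small_prime[of c S n E A r] G(2,4) S(1,2) E(1) by blast
  have "prime_height (poly_ring (graph_vars n)) P < enat (card E)"
    using P(3) S(3) by (metis enat_ord_simps(2) le_less_trans)
  then show ?thesis using P by blast
qed

text \<open>The parameter \<open>c\<close> treats both ideals at once. As the minimal number of
  generators is \<open>card E\<close>, everything rests on comparing the height with
  \<open>card E\<close>.\<close>

lemma complete_intersection_iff:
  fixes c :: "'k::field"
  assumes G: "simple_graph n E" "bipartite n E" and c: "c \<noteq> 0"
  shows "complete_intersection (graph_vars n) (Idl\<^bsub>poly_ring (graph_vars n)\<^esub> (edge_gens c E)) \<longleftrightarrow>
    disjoint_union_of_paths n E"
proof -
  let ?V = "graph_vars n"
  let ?R = "poly_ring ?V :: (var, 'k) mpoly ring"
  let ?F = "edge_gens c E"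
  let ?I = "Idl\<^bsub>?R\<^esub> ?F"
  have E: "e \<subseteq> {1..n}" "card e = 2" if "e \<in> E" for e
    using G(1) that by (auto simp: simple_graph_def)
  have fin: "finite E"
    by (rule finite_subset[of _ "Pow {1..n}"]) (use E in auto)
  obtain A where A: "\<And>i j. {i, j} \<in> E \<Longrightarrow> i \<in> A \<longleftrightarrow> j \<notin> A"
  proof -
    obtain A B where AB: "A \<inter> B = {}" "\<And>e. e \<in> E \<Longrightarrow> \<exists>a\<in>A. \<exists>b\<in>B. e = {a, b}"
      using G(2) by (auto simp: bipartite_def)
    have "i \<in> A \<longleftrightarrow> j \<notin> A" if "{i, j} \<in> E" for i j
      using AB(2)[OF that] AB(1) by (auto simp: doubleton_eq_iff)
    then show ?thesis by (rule that)
  qed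
  have FV: "?F \<subseteq> polys ?V" using E by (intro edge_gens_polys) auto
  have FQ: "?F \<subseteq> quadrics ?V"
    unfolding edge_gens_def using E(1) edge_gen_quadric[of _ n _ c] by fastforce
  note ind = edge_gens_independent[OF E(2) fin, of c]
  have mu: "min_num_generators ?V ?I = card E"
    using min_num_generators_quadrics[OF FQ ind(1,3)] ind(2) by simp
  have hom: "homogeneous_ideal ?V ?I"
    using generating_set_of_span[OF FQ, of ?F] mpoly.span_base[of _ ?F]
    unfolding homogeneous_ideal_def by blast
  have upper: "height ?R ?I \<le> prime_height ?R P" if "primeideal P ?R" "?F \<subseteq> P" for P
    unfolding height_def
    using that Idl_subset[OF primeideal_imp_ideal, OF that] by (intro Inf_lower) blast
  show ?thesis
  proof
    assume "complete_intersection ?V ?I"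
    then have h: "height ?R ?I = enat (card E)"
      using mu by (simp add: complete_intersection_def)
    show "disjoint_union_of_paths n E"
    proof (rule ccontr)
      assume "\<not> ?thesis"
      then obtain P where "primeideal P ?R" "?F \<subseteq> P" "prime_height ?R P < enat (card E)"
        using height_less_if_not_paths[OF G(1) A fin c] by blast
      then show False using upper[of P] h by simp
    qed
  next
    assume paths: "disjoint_union_of_paths n E"
    have "enat (card E) \<le> height ?R ?I"
      unfolding height_def
    proof (rule Inf_greatest, clarify)
      fix P assume P: "primeideal P ?R" "?I \<subseteq> P"
      then have "?F \<subseteq> P" using Idl_self[OF FV] by auto
      then show "enat (card E) \<le> prime_height ?R P"
        using prime_height_path_cover_ge[OF paths fin _ P(1) _ c] E by blast
    qed
    \<comment> \<open>Equality also needs an upper bound. A class map losing at most one class per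
      edge, with \<open>S\<close> empty, gives an explicit prime of height at most
      \<open>card E\<close>.\<close>
    moreover have "height ?R ?I \<le> enat (card E)"
    proof -
      obtain r :: "nat \<Rightarrow> nat" where r: "\<forall>a b. {a, b} \<in> E \<longrightarrow> r a = r b"
          "card {1..n} \<le> card (r ` {1..n}) + card E"
        using class_map_exists[of E "{1..n}"] fin E(2) by auto
      obtain P where P: "primeideal P ?R" "?F \<subseteq> P"
          "prime_height ?R P \<le> enat (n + card ({}::nat set) - card (r ` ({1..n} - {})))"
        using small_prime[of c "{}" n E A r] c A r(1) E(1) by blast
      have "height ?R ?I \<le> prime_height ?R P" by (rule upper[OF P(1,2)])
      also note P(3)
      also have "enat (n + card ({}::nat set) - card (r ` ({1..n} - {}))) \<le> enat (card E)"
        using r(2) by simp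
      finally show ?thesis .
    qed
    ultimately show "complete_intersection ?V ?I"
      using mu hom by (simp add: complete_intersection_def)
  qed
qed

theorem theorem3p2:
  fixes n :: nat and E :: "nat set set"
  assumes "simple_graph n E" and "bipartite n E"
  shows "(complete_intersection (graph_vars n) (lss_ideal n E :: (var, 'k::field) mpoly set) \<longleftrightarrow>
            complete_intersection (graph_vars n)
              (parity_binomial_edge_ideal n E :: (var, 'k) mpoly set)) \<and>
         (complete_intersection (graph_vars n)
            (parity_binomial_edge_ideal n E :: (var, 'k) mpoly set) \<longleftrightarrow>
            disjoint_union_of_paths n E)"
proof -
  \<comment> \<open>The two ideals are the instances \<open>c = 1\<close> and
    \<open>c = - 1\<close>.\<close>
  have "edge_gen (1::'k) i j = indet (X i) * indet (X j) + indet (Y i) * indet (Y j)"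
      "edge_gen (- 1::'k) i j = indet (X i) * indet (X j) - indet (Y i) * indet (Y j)" for i j
    by (simp_all add: edge_gen_def single_uminus)
  then have "lss_ideal n E = Idl\<^bsub>poly_ring (graph_vars n)\<^esub> (edge_gens (1::'k) E)"
      "parity_binomial_edge_ideal n E = Idl\<^bsub>poly_ring (graph_vars n)\<^esub> (edge_gens (- 1::'k) E)"
    unfolding lss_ideal_def parity_binomial_edge_ideal_def edge_gens_def by (simp_all only:)
  then show ?thesis
    using complete_intersection_iff[OF assms, of "1::'k"] complete_intersection_iff[OF assms, of "- 1::'k"]
    by simp
qed

end
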